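(* Let $\lambda>0$, $t>0$ and $\nu\in(0,1]$. Let $\mathfrak{N}^\nu(t)$ be the number of individuals at time $t$ in a fractional Yule process with rate $\lambda$ and one initial progenitor. Let $\Xi$ be a Wright-distributed random variable, with probability density function $W_{-\nu,1-\nu}(-\xi)$, $\xi>0$, and let $\mathcal{N}_\Xi(t^\nu)$ be a classical linear birth (Yule) process with one initial progenitor and random rate $\lambda\Xi$, evaluated at time $t^\nu$ (that is, conditionally on $\Xi=\xi$, it is the classical Yule process with birth rate $\lambda\xi$ at time $t^\nu$). Then the following equality in distribution holds: $$\mathfrak{N}^\nu(t)\overset{d}{=}\mathcal{N}_\Xi(t^\nu).$$
   Context: Classical Yule process with rate $\mu$ and one progenitor: the linear pure birth process on $\{1,2,\dots\}$ with birth rate $\mu k$ in state $k$; its law at time $t$ is $e^{-\mu t}(1-e^{-\mu t})^{k-1}$, $k\ge1$. Fractional Yule process with rate $\lambda$: its state probabilities $\mathfrak{p}^\nu_k(t)=\Pr\{\mathfrak{N}^\nu(t)=k\mid \mathfrak{N}^\nu(0)=1\}$ are the solution of $\frac{d^\nu}{dt^\nu}\mathfrak{p}^\nu_k(t)=-\lambda k\,\mathfrak{p}^\nu_k(t)+\lambda(k-1)\mathfrak{p}^\nu_{k-1}(t)$, $k\ge1$, with $\mathfrak{p}^\nu_1(0)=1$ and $\mathfrak{p}^\nu_k(0)=0$ for $k>1$. Here $\frac{d^\nu}{dt^\nu}$ is the Caputo derivative, $\frac{d^\nu}{dt^\nu}f(t)=\frac{1}{\Gamma(1-\nu)}\int_0^t\frac{f'(s)}{(t-s)^\nu}ds$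 for $\nu\in(0,1)$ and $f'(t)$ for $\nu=1$. Explicitly, $$\mathfrak{p}^\nu_k(t)=\sum_{l=1}^k\binom{k-1}{l-1}(-1)^{l-1}E_{\nu,1}(-\lambda l t^\nu),\qquad E_{\alpha,\beta}(\tau)=\sum_{r\ge0}\frac{\tau^r}{\Gamma(\alpha r+\beta)}.$$ The Wright density is $$W_{-\nu,1-\nu}(-\xi)=\sum_{r=0}^\infty\frac{(-\xi)^r}{r!\,\Gamma(1-\nu(r+1))},\qquad \xi>0,$$ with $1/\Gamma=0$ at the poles of $\Gamma$. For $\nu=1$ the Wright distribution is understood as the point mass at $1$. Equality in distribution refers to the one-dimensional law at the fixed time $t$. *)

theory Defs
  imports "HOL-Probability.Probability"
begin

section \<open>The Caputo derivative\<close>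

text \<open>
  The Bochner integral of a non-integrable function is 0 by convention, so the existence of the
  Caputo derivative at \<open>t > 0\<close> has to be demanded separately from its value. For
  \<open>\<nu> < 1\<close>, integrability of the integrand below already implies that \<open>f'\<close> is integrable on
  \<open>(0,t)\<close>; \<open>f'\<close> may be unbounded at 0, as it is for Mittag-Leffler functions.
\<close>

definition caputo_differentiable :: "real \<Rightarrow> (real \<Rightarrow> real) \<Rightarrow> real \<Rightarrow> bool" where
  "caputo_differentiable \<nu> f t \<longleftrightarrow>
     (if \<nu> = 1 then f differentiable (at t)
      else (\<forall>s\<in>{0<..<t}. f differentiable (at s)) \<and>
           set_integrable lborel {0<..<t} (\<lambda>s. deriv f s / (t - s) powr \<nu>))"

definition caputo_deriv :: "real \<Rightarrow> (real \<Rightarrow> real) \<Rightarrow> real \<Rightarrow> real" where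
  "caputo_deriv \<nu> f t =
     (if \<nu> = 1 then deriv f t
      else 1 / Gamma (1 - \<nu>) * (LBINT s:{0<..<t}. deriv f s / (t - s) powr \<nu>))"


section \<open>The fractional Yule process\<close>

text \<open>
  \<open>p k t\<close> is the probability of state \<open>k \<ge> 1\<close> at time \<open>t \<ge> 0\<close>. For \<open>k = 1\<close> the term with
  \<open>p 0\<close> has coefficient 0. Continuity ties the equation, which lives on \<open>t > 0\<close>, to the initial
  condition.
\<close>

definition fractional_yule_probs :: "real \<Rightarrow> real \<Rightarrow> (nat \<Rightarrow> real \<Rightarrow> real) \<Rightarrow> bool" where
  "fractional_yule_probs \<nu> lam p \<longleftrightarrow>
     (\<forall>k\<ge>1. continuous_on {0..} (p k) \<and>
            p k 0 = (if k = 1 then 1 else 0) \<and>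
            (\<forall>t>0. caputo_differentiable \<nu> (p k) t \<and>
                   caputo_deriv \<nu> (p k) t =
                     - lam * real k * p k t + lam * real (k - 1) * p (k - 1) t))"

text \<open>
  The initial condition \<open>p 1 0 = 1\<close> says that the process starts from one progenitor almost
  surely, so conditioning on the initial state is not needed. Only the one-dimensional laws of
  the process are prescribed.
\<close>

definition fractional_yule_process ::
    "'a measure \<Rightarrow> real \<Rightarrow> real \<Rightarrow> (real \<Rightarrow> 'a \<Rightarrow> nat) \<Rightarrow> bool" where
  "fractional_yule_process M \<nu> lam N \<longleftrightarrow>
     prob_space M \<and>
     (\<forall>t\<ge>0. N t \<in> M \<rightarrow>\<^sub>M count_space {1..}) \<and>
     fractional_yule_probs \<nu> lam (\<lambda>k t. measure M {\<omega> \<in> space M. N t \<omega> = k})"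


section \<open>The classical Yule process with a fixed or a random rate\<close>

text \<open>
  The Kolmogorov forward equations of the pure birth process on \<open>{1, 2, \<dots>}\<close> started in 1, with
  birth rate \<open>b k\<close> in state \<open>k\<close>.
\<close>

definition pure_birth_probs :: "(nat \<Rightarrow> real) \<Rightarrow> (nat \<Rightarrow> real \<Rightarrow> real) \<Rightarrow> bool" where
  "pure_birth_probs b p \<longleftrightarrow>
     (\<forall>k\<ge>1. continuous_on {0..} (p k) \<and>
            p k 0 = (if k = 1 then 1 else 0) \<and>
            (\<forall>t>0. (p k has_real_derivative
                      (if k = 1 then 0 else b (k - 1) * p (k - 1) t) - b k * p k t) (at t)))"

definition yule_probs :: "real \<Rightarrow> (nat \<Rightarrow> real \<Rightarrow> real) \<Rightarrow> bool" where
  "yule_probs \<mu> p \<longleftrightarrow> pure_birth_probs (\<lambda>k. \<mu> * real k) p"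

lemma yule_probs_explicit:
  "yule_probs \<mu> (\<lambda>k t. exp (- \<mu> * t) * (1 - exp (- \<mu> * t)) ^ (k - 1))"
proof -
  have deriv: "((\<lambda>t. exp (- \<mu> * t) * (1 - exp (- \<mu> * t)) ^ (k - 1)) has_real_derivative
          (if k = 1 then 0
           else \<mu> * real (k - 1) * (exp (- \<mu> * t) * (1 - exp (- \<mu> * t)) ^ (k - 1 - 1)))
          - \<mu> * real k * (exp (- \<mu> * t) * (1 - exp (- \<mu> * t)) ^ (k - 1))) (at t)"
    if "k \<ge> 1" for k :: nat and t
  proof -
    define e where "e = exp (- \<mu> * t)"
    have e: "((\<lambda>t. exp (- \<mu> * t)) has_real_derivative - \<mu> * e) (at t)"
      unfolding e_def by (auto intro!: derivative_eq_intros)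
    have "((\<lambda>t. exp (- \<mu> * t) * (1 - exp (- \<mu> * t)) ^ (k - 1)) has_real_derivative
            - \<mu> * e * (1 - e) ^ (k - 1)
            + real (k - 1) * (1 - e) ^ (k - 1 - 1) * (\<mu> * e) * e) (at t)"
      using DERIV_mult[OF e DERIV_power[OF DERIV_diff[OF DERIV_const[of 1] e], of "k - 1"]]
      unfolding e_def[symmetric] by (rule DERIV_cong) (simp add: mult_ac)
    also have "- \<mu> * e * (1 - e) ^ (k - 1) + real (k - 1) * (1 - e) ^ (k - 1 - 1) * (\<mu> * e) * e =
        (if k = 1 then 0 else \<mu> * real (k - 1) * (e * (1 - e) ^ (k - 1 - 1)))
          - \<mu> * real k * (e * (1 - e) ^ (k - 1))"
    proof (cases "k = 1")
      case False
      with that have "k = Suc (Suc (k - 2))"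
        by simp
      then obtain j where j: "k = Suc (Suc j)" ..
      show ?thesis
        unfolding j diff_Suc_Suc diff_Suc_1 One_nat_def diff_zero
        by (simp add: ring_distribs)
    qed simp
    finally show ?thesis
      unfolding e_def .
  qed
  have init: "exp (- \<mu> * 0) * (1 - exp (- \<mu> * 0)) ^ (k - 1) = (if k = 1 then 1 else 0)"
    if "k \<ge> 1" for k :: nat
    using that by simp
  have cont: "continuous_on {0..} (\<lambda>t. exp (- \<mu> * t) * (1 - exp (- \<mu> * t)) ^ (k - 1))"
    for k :: nat
    by (intro continuous_intros)
  show ?thesis
    unfolding yule_probs_def pure_birth_probs_def
    using deriv init cont by blast
qed

text \<open>
  A Yule process whose rate is the random variable \<open>lam * \<Xi>\<close>: the conditional probability of the
  event \<open>X s = k\<close> given \<open>\<Xi>\<close> is the state probability, at time \<open>s\<close>, of the Yule process with rate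
  \<open>lam * \<Xi>\<close> and one progenitor. It is meant for \<open>lam > 0\<close> and \<open>\<Xi> > 0\<close> almost surely.
\<close>

definition random_rate_yule_process ::
    "'a measure \<Rightarrow> real \<Rightarrow> ('a \<Rightarrow> real) \<Rightarrow> (real \<Rightarrow> 'a \<Rightarrow> nat) \<Rightarrow> bool" where
  "random_rate_yule_process M lam \<Xi> X \<longleftrightarrow>
     prob_space M \<and>
     \<Xi> \<in> borel_measurable M \<and>
     (\<forall>s\<ge>0. X s \<in> M \<rightarrow>\<^sub>M count_space {1..}) \<and>
     (\<exists>q. (\<forall>\<mu>>0. yule_probs \<mu> (q \<mu>)) \<and>
          (\<forall>s\<ge>0. \<forall>k\<ge>1. AE \<omega> in M.
             real_cond_exp M (vimage_algebra (space M) \<Xi> borel)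
               (indicator {\<omega> \<in> space M. X s \<omega> = k}) \<omega> = q (lam * \<Xi> \<omega>) k s))"


section \<open>The Wright distribution\<close>

definition wright :: "real \<Rightarrow> real \<Rightarrow> real \<Rightarrow> real" where
  "wright \<alpha> \<beta> z = (\<Sum>r. z ^ r / fact r * rGamma (\<alpha> * real r + \<beta>))"

definition wright_distributed :: "'a measure \<Rightarrow> real \<Rightarrow> ('a \<Rightarrow> real) \<Rightarrow> bool" where
  "wright_distributed M \<nu> \<Xi> \<longleftrightarrow>
     (if \<nu> = 1 then \<Xi> \<in> borel_measurable M \<and> distr M borel \<Xi> = return borel 1
      else distributed M lborel \<Xi>
             (\<lambda>\<xi>. ennreal (if \<xi> > 0 then wright (- \<nu>) (1 - \<nu>) (- \<xi>) else 0)))"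

end

theory Submission
  imports Defs "HOL-Complex_Analysis.Cauchy_Integral_Theorem" "HOL-Real_Asymp.Real_Asymp"
begin

text \<open>
  Both laws are determined by their binomial transforms
  \<open>c m = (\<Sum>j\<le>m. (m choose j) (-1)^j Pr(state = j + 1))\<close>, and both transforms equal
  \<open>E(- (m + 1) lam t^\<nu>)\<close>, where \<open>E(x) = (\<Sum>n. x^n / \<Gamma>(1 + n \<nu>))\<close> is the Mittag-Leffler function.

  On the side of the fractional process, the transform diagonalises the system of Caputo equations:
  \<open>c m\<close> satisfies a scalar equation with rate \<open>a = lam (m + 1)\<close>. Applying the Riemann-Liouville
  integral turns it into the Volterra equation \<open>c = 1 - a I^\<nu> c\<close>
  (\<open>fractional_yule_transform_volterra\<close>). Iterating this equation \<open>n\<close> times produces the first \<open>n\<close>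
  terms of the Mittag-Leffler series, and the remainder is at most a constant times the next term
  (\<open>volterra_solution\<close>). This proves uniqueness and gives the solution at once.

  On the side of the mixture, given \<open>\<Xi>\<close> the state at time \<open>s = t^\<nu>\<close> is geometric with parameter
  \<open>exp (- lam s \<Xi>)\<close>, and the transform of a geometric law is a power of its parameter; hence
  \<open>c m\<close> is the Laplace transform of \<open>\<Xi>\<close> at \<open>lam (m + 1) s\<close> (\<open>random_rate_yule_transform\<close>).

  It remains to show that the Laplace transform of the Wright density at \<open>s\<close> is \<open>E(- s)\<close>. Hankel's
  formula writes \<open>1 / \<Gamma>(z)\<close> as \<open>1 / (2 \<pi> i)\<close> times the integral of \<open>e^\<sigma> \<sigma>^(-z)\<close> over a contour around
  the negative axis. Summed over the Wright series, it represents the density as the integral of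
  \<open>e^\<sigma> \<sigma>^(\<nu> - 1) e^(- \<xi> \<sigma>^\<nu>)\<close>. When the arms of the contour have an argument \<open>\<theta>\<close> with
  \<open>\<pi>/2 < \<theta> < \<pi>/(2 \<nu>)\<close>, both \<open>e^\<sigma>\<close> and \<open>e^(- \<xi> \<sigma>^\<nu>)\<close> decay, Fubini's theorem applies, and
  integrating over \<open>\<xi>\<close> leaves \<open>e^\<sigma> \<sigma>^(\<nu> - 1) / (s + \<sigma>^\<nu>)\<close>. If the contour keeps far enough from 0, this
  is a geometric series in \<open>- s / \<sigma>^\<nu>\<close>, and Hankel's formula applied to its terms gives \<open>E(- s)\<close>
  (\<open>wright_laplace\<close>). At \<open>s = 0\<close> this says that the Wright function has integral 1. Its positive part is the
  density of \<open>\<Xi>\<close> and has integral 1 as well, so the function is nonnegative almost everywhere and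
  is itself the density (\<open>wright_density_nonneg\<close>). For \<open>\<nu> = 1\<close> the point mass at 1 has the Laplace transform
  \<open>e^(- s)\<close>, which is \<open>E(- s)\<close>.
\<close>


section \<open>Hankel's integral for the reciprocal Gamma function\<close>

text \<open>
  This is \<open>e^\<sigma> \<sigma>^(-z) d\<sigma>\<close> in the variable \<open>\<zeta> = ln \<sigma>\<close>. The logarithmic variable removes the branch cut:
  the kernel is entire, so it has a primitive on the whole plane, and deforming a contour amounts to
  comparing values of that primitive.
\<close>

definition hankel_kernel :: "real \<Rightarrow> complex \<Rightarrow> complex" where
  "hankel_kernel z \<zeta> = exp (exp \<zeta> + of_real (1 - z) * \<zeta>)"

lemma hankel_kernel_holomorphic: "hankel_kernel z holomorphic_on A"
  unfolding hankel_kernel_def by (intro holomorphic_intros)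

lemma norm_hankel_kernel:
  "norm (hankel_kernel z \<zeta>) = exp (exp (Re \<zeta>) * cos (Im \<zeta>) + (1 - z) * Re \<zeta>)"
  by (simp add: hankel_kernel_def Re_exp)

lemma hankel_primitive_exists:
  obtains P where "\<And>\<zeta>. (P has_field_derivative hankel_kernel z \<zeta>) (at \<zeta>)"
  using holomorphic_convex_primitive'[OF convex_UNIV open_UNIV hankel_kernel_holomorphic] by auto

text \<open>
  Used to show that vertical segments carry no mass in the limit, so that horizontal lines can be shifted.
\<close>

lemma primitive_increment_vertical:
  assumes "\<And>\<zeta>. (P has_field_derivative f \<zeta>) (at \<zeta>)" "a \<le> b"
    and "\<And>y. a \<le> y \<Longrightarrow> y \<le> b \<Longrightarrow> norm (f (Complex v y)) \<le> B"
  shows "norm (P (Complex v b) - P (Complex v a)) \<le> B * (b - a)"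
proof -
  let ?S = "cbox (Complex v a) (Complex v b)"
  have "norm (P (Complex v b) - P (Complex v a)) \<le> B * norm (Complex v b - Complex v a)"
  proof (rule field_differentiable_bound[of ?S P f])
    show "(P has_field_derivative f \<zeta>) (at \<zeta> within ?S)" for \<zeta>
      using assms(1) by (rule has_field_derivative_at_within)
    show "norm (f \<zeta>) \<le> B" if "\<zeta> \<in> ?S" for \<zeta>
      using that assms(3)[of "Im \<zeta>"] by (cases \<zeta>) (auto simp: in_cbox_complex_iff)
  qed (use assms(2) in \<open>auto simp: in_cbox_complex_iff\<close>)
  also have "norm (Complex v b - Complex v a) = b - a"
    using assms(2) by (simp add: cmod_def)
  finally show ?thesis .
qed

lemma truncated_integral_tendsto:
  fixes f :: "real \<Rightarrow> 'b::euclidean_space"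
  assumes "integrable lborel f"
  shows "((\<lambda>U. integral {-U..U} f) \<longlongrightarrow> integral\<^sup>L lborel f) at_top"
proof -
  have "((\<lambda>U. \<integral>x. indicator {-U..U} x *\<^sub>R f x \<partial>lborel) \<longlongrightarrow> integral\<^sup>L lborel f) at_top"
  proof (rule integral_dominated_convergence_at_top)
    show "integrable lborel (\<lambda>x. norm (f x))" using assms by simp
    show "AE x in lborel. ((\<lambda>U. indicator {-U..U} x *\<^sub>R f x) \<longlongrightarrow> f x) at_top"
    proof (rule AE_I2)
      fix x :: real
      have "eventually (\<lambda>U. U \<ge> \<bar>x\<bar>) at_top" by (rule eventually_ge_at_top)
      then have "eventually (\<lambda>U. indicator {-U..U} x *\<^sub>R f x = f x) at_top"
        by eventually_elim (auto simp: indicator_def)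
      then show "((\<lambda>U. indicator {-U..U} x *\<^sub>R f x) \<longlongrightarrow> f x) at_top"
        by (rule tendsto_eventually)
    qed
    show "\<forall>\<^sub>F U in at_top. AE x in lborel. norm (indicator {-U..U} x *\<^sub>R f x) \<le> norm (f x)"
      by (auto intro!: always_eventually AE_I2 simp: indicator_def)
  qed (use assms in \<open>auto\<close>)
  also have "(\<lambda>U. \<integral>x. indicator {-U..U} x *\<^sub>R f x \<partial>lborel) = (\<lambda>U. integral {-U..U} f)"
  proof
    fix U :: real
    have "set_integrable lborel {-U..U} f"
      unfolding set_integrable_def using assms by (intro integrable_mult_indicator) auto
    from set_borel_integral_eq_integral(2)[OF this]
    show "(\<integral>x. indicator {-U..U} x *\<^sub>R f x \<partial>lborel) = integral {-U..U} f"
      by (simp add: set_lebesgue_integral_def)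
  qed
  finally show ?thesis .
qed

text \<open>
  Euler's integral in the variable \<open>v = ln t\<close>.
\<close>

lemma exp_Gamma_integral:
  assumes "a > (0::real)"
  shows "integrable lborel (\<lambda>v. exp (- exp v + a * v))"
    and "(LBINT v. exp (- exp v + a * v)) = Gamma a"
proof -
  let ?f = "\<lambda>t. t powr (a - 1) / exp t"
  have "?f absolutely_integrable_on {0..}"
    using Gamma_integral_real[OF assms] by (intro nonnegative_absolutely_integrable_1) auto
  then have "?f absolutely_integrable_on {0<..}"
    by (rule set_integrable_subset) auto
  moreover have "(?f has_integral Gamma a) {0<..}"
    using Gamma_integral_real[OF assms]
    by (subst has_integral_spike_set_eq[of _ "{0..}"])
       (auto intro!: negligible_subset[OF negligible_sing[of 0]])
  moreover have "exp ` (UNIV :: real set) = {0<..}"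
    by (auto simp: image_iff intro: exp_ln[symmetric])
  ultimately have "(\<lambda>v. \<bar>exp v\<bar> * ?f (exp v)) absolutely_integrable_on UNIV \<and>
      integral UNIV (\<lambda>v. \<bar>exp v\<bar> * ?f (exp v)) = Gamma a"
    by (subst has_absolute_integral_change_of_variables_1'[of UNIV exp exp ?f])
       (auto intro!: derivative_eq_intros simp: integral_unique inj_on_def)
  also have "(\<lambda>v. \<bar>exp v\<bar> * ?f (exp v)) = (\<lambda>v. exp (- exp v + a * v))"
    by (auto simp: powr_def exp_add exp_diff exp_minus field_simps ring_distribs)
  finally have *: "integrable lebesgue (\<lambda>v. exp (- exp v + a * v))"
      "integral UNIV (\<lambda>v. exp (- exp v + a * v)) = Gamma a"
    by (auto simp: set_integrable_def)
  show **: "integrable lborel (\<lambda>v. exp (- exp v + a * v))"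
    using *(1) by (subst (asm) integrable_completion) auto
  show "(LBINT v. exp (- exp v + a * v)) = Gamma a"
    using *(2) integral_lborel[OF **] by simp
qed


context
  fixes z :: real and P :: "complex \<Rightarrow> complex"
  assumes P: "\<And>\<zeta>. (P has_field_derivative hankel_kernel z \<zeta>) (at \<zeta>)"
begin

lemma hankel_primitive_line_derivative:
  "((\<lambda>v. P (Complex v y)) has_vector_derivative hankel_kernel z (Complex v y)) (at v within A)"
proof -
  have "((\<lambda>v. Complex v y) has_vector_derivative 1) (at v within A)"
    unfolding complex_eq_iff Complex_eq by (auto intro!: derivative_eq_intros)
  from field_vector_diff_chain_within[OF this has_field_derivative_at_within[OF P]]
  show ?thesis by (simp add: o_def)
qed

text \<open>
  On the two edges of the branch cut the kernel takes values that differ only by the phase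
  \<open>e^(\<plusminus> i \<pi> (1 - z))\<close>; the jump is a multiple of the integrand of \<open>\<Gamma>(1 - z)\<close>.
\<close>

lemma hankel_kernel_at_pi:
  "hankel_kernel z (Complex v pi) - hankel_kernel z (Complex v (- pi)) =
     2 * \<i> * sin (of_real (pi * (1 - z))) * of_real (exp (- exp v + (1 - z) * v))"
proof -
  have e: "exp (Complex v pi) = - of_real (exp v)" "exp (Complex v (- pi)) = - of_real (exp v)"
    by (auto simp: complex_eq_iff Re_exp Im_exp)
  have "hankel_kernel z (Complex v pi) =
      of_real (exp (- exp v + (1 - z) * v)) * exp (\<i> * of_real (pi * (1 - z)))"
    unfolding hankel_kernel_def e
    by (simp add: Complex_eq exp_of_real[symmetric] exp_add[symmetric] algebra_simps)
  moreover have "hankel_kernel z (Complex v (- pi)) =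
      of_real (exp (- exp v + (1 - z) * v)) * exp (- (\<i> * of_real (pi * (1 - z))))"
    unfolding hankel_kernel_def e
    by (simp add: Complex_eq exp_of_real[symmetric] exp_add[symmetric] algebra_simps)
  moreover have "2 * \<i> * sin x = exp (\<i> * x) - exp (- (\<i> * x))" for x :: complex
    by (simp add: sin_exp_eq)
  ultimately show ?thesis
    by (simp only:) (simp add: algebra_simps)
qed

text \<open>
  For \<open>z < 1\<close> the increment over an arc of radius \<open>e^V\<close> tends to 0 as \<open>V\<close> tends to \<open>-\<infinity>\<close>, so only the jump
  across the cut is left. It gives \<open>2 i sin (\<pi> z) \<Gamma>(1 - z)\<close>, which the reflection formula identifies.
\<close>

lemma hankel_limit_at_pi_lt_1:
  assumes "z < 1"
  shows "((\<lambda>V. P (Complex V pi) - P (Complex V (- pi))) \<longlongrightarrow> 2 * pi * \<i> * of_real (rGamma z)) at_top"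
proof -
  let ?D = "\<lambda>V. P (Complex V pi) - P (Complex V (- pi))"
  let ?I = "\<lambda>v. exp (- exp v + (1 - z) * v)"
  let ?c = "2 * \<i> * sin (complex_of_real (pi * (1 - z)))"
  have D: "?D V = ?D (- V) + ?c * of_real (integral {-V..V} ?I)" if "V \<ge> 0" for V
  proof -
    have "((\<lambda>v. hankel_kernel z (Complex v pi) - hankel_kernel z (Complex v (- pi)))
        has_integral ?D V - ?D (- V)) {-V..V}"
      using that by (intro fundamental_theorem_of_calculus has_vector_derivative_diff
          hankel_primitive_line_derivative) auto
    moreover have "(?I has_integral integral {-V..V} ?I) {-V..V}"
      by (intro integrable_integral integrable_continuous_real continuous_intros)
    then have "((\<lambda>v. ?c * of_real (?I v)) has_integral ?c * of_real (integral {-V..V} ?I)) {-V..V}"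
      by (intro has_integral_mult_right has_integral_of_real)
    ultimately show ?thesis
      unfolding hankel_kernel_at_pi by (auto dest: has_integral_unique simp: algebra_simps)
  qed
  have "(?D \<longlongrightarrow> 0) at_bot"
  proof (rule Lim_null_comparison)
    have "norm (?D V) \<le> exp (exp V + (1 - z) * V) * (2 * pi)" for V
      using primitive_increment_vertical[OF P, of "- pi" pi V "exp (exp V + (1 - z) * V)"]
      by (auto simp: norm_hankel_kernel mult_left_le)
    then show "\<forall>\<^sub>F V in at_bot. norm (?D V) \<le> exp (exp V + (1 - z) * V) * (2 * pi)"
      by simp
    have "((\<lambda>V. exp (exp V) * (exp ((1 - z) * V) * (2 * pi))) \<longlongrightarrow> 1 * 0) at_bot"
      using assms by (intro tendsto_mult) real_asymp+
    then show "((\<lambda>V. exp (exp V + (1 - z) * V) * (2 * pi)) \<longlongrightarrow> 0) at_bot"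
      by (simp add: exp_add mult_ac)
  qed
  then have lim0: "((\<lambda>V. ?D (- V)) \<longlongrightarrow> 0) at_top"
    by (rule filterlim_compose) (rule filterlim_uminus_at_bot_at_top)
  have "((\<lambda>V. ?D (- V) + ?c * of_real (integral {-V..V} ?I)) \<longlongrightarrow>
      0 + ?c * of_real (LBINT v. ?I v)) at_top"
    using assms by (intro tendsto_intros lim0 truncated_integral_tendsto exp_Gamma_integral) auto
  also have "0 + ?c * of_real (LBINT v. ?I v) = 2 * pi * \<i> * of_real (rGamma z)"
  proof -
    have "complex_of_real (rGamma z * rGamma (1 - z)) = of_real (sin (pi * z) / pi)"
      using rGamma_reflection_complex[of "of_real z"] rGamma_complex_of_real[of "1 - z"]
      by (simp add: rGamma_complex_of_real sin_of_real[symmetric])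
    then have "pi * (rGamma z * rGamma (1 - z)) = sin (pi * z)"
      by (simp only: of_real_eq_iff) simp
    moreover have one: "rGamma (1 - z) * Gamma (1 - z) = 1"
      using assms Gamma_real_pos[of "1 - z"] by (simp add: Gamma_def)
    moreover have "sin (pi * (1 - z)) = sin (pi * z)"
      by (simp add: algebra_simps sin_diff)
    ultimately have eqs: "pi * (rGamma z * rGamma (1 - z)) = sin (pi * z)" "sin (pi * (1 - z)) = sin (pi * z)" by auto
    then have "sin (pi * (1 - z)) * Gamma (1 - z) = pi * rGamma z * (rGamma (1 - z) * Gamma (1 - z))"
      unfolding eqs(2) eqs(1)[symmetric] by (simp only: mult.assoc)
    also have "\<dots> = pi * rGamma z"
      using one by simp
    finally have "sin (pi * (1 - z)) * Gamma (1 - z) = pi * rGamma z" .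
    then have "complex_of_real (sin (pi * (1 - z))) * of_real (Gamma (1 - z)) = of_real pi * of_real (rGamma z)"
      by (simp only: of_real_mult[symmetric])
    then show ?thesis
      unfolding exp_Gamma_integral(2)[of "1 - z", unfolded diff_gt_0_iff_gt, OF assms] sin_of_real
      by (simp add: mult_ac)
  qed
  finally show ?thesis
    by (rule Lim_transform_eventually)
       (rule eventually_mono[OF eventually_ge_at_top[of 0] D[symmetric]])
qed

text \<open>
  At \<open>z = 1\<close> the kernel is \<open>2 \<pi> i\<close>-periodic, so the increment of the primitive over a period does not depend on
  \<open>V\<close>, and its limit at \<open>V = -\<infinity>\<close> is that of \<open>\<zeta>\<close> itself, because the kernel tends to 1 there. This is the
  residue of \<open>e^\<sigma> / \<sigma>\<close> at 0.
\<close>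

lemma hankel_limit_at_pi_eq_1:
  assumes "z = 1"
  shows "((\<lambda>V. P (Complex V pi) - P (Complex V (- pi))) \<longlongrightarrow> 2 * pi * \<i>) at_top"
proof -
  let ?D = "\<lambda>V. P (Complex V pi) - P (Complex V (- pi))"
  have "(?D has_vector_derivative 0) (at V)" for V
    using has_vector_derivative_diff[OF hankel_primitive_line_derivative[of pi V UNIV]
        hankel_primitive_line_derivative[of "- pi" V UNIV]]
    unfolding hankel_kernel_at_pi by (simp add: assms)
  then obtain c where c: "\<And>V. ?D V = c"
    using has_vector_derivative_zero_constant[of UNIV ?D] by (metis UNIV_I convex_UNIV)
  have "((\<lambda>V. ?D V - 2 * pi * \<i>) \<longlongrightarrow> 0) at_bot"
  proof (rule Lim_null_comparison)
    have "norm (?D V - 2 * pi * \<i>) \<le> exp V * exp (exp V) * (2 * pi)" for V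
    proof -
      have "((\<lambda>\<zeta>. P \<zeta> - \<zeta>) has_field_derivative (hankel_kernel z \<zeta> - 1)) (at \<zeta>)" for \<zeta>
        by (intro DERIV_diff P DERIV_ident)
      moreover have "norm (hankel_kernel z (Complex V y) - 1) \<le> exp V * exp (exp V)" for y
      proof -
        let ?w = "exp (Complex V y)"
        have "norm (exp ?w - exp 0) \<le> exp (exp V) * norm (?w - 0)"
          by (rule field_differentiable_bound[of "cball 0 (norm ?w)" exp exp])
             (auto intro!: derivative_eq_intros simp: order.trans[OF complex_Re_le_cmod])
        then show ?thesis
          by (simp add: hankel_kernel_def assms mult.commute)
      qed
      ultimately show ?thesis
        using primitive_increment_vertical[of "\<lambda>\<zeta>. P \<zeta> - \<zeta>" "\<lambda>\<zeta>. hankel_kernel z \<zeta> - 1" "- pi" pi V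
            "exp V * exp (exp V)"]
        by (auto simp: Complex_eq algebra_simps)
    qed
    then show "\<forall>\<^sub>F V in at_bot. norm (?D V - 2 * pi * \<i>) \<le> exp V * exp (exp V) * (2 * pi)"
      by simp
    show "((\<lambda>V. exp V * exp (exp V) * (2 * pi)) \<longlongrightarrow> 0) at_bot"
      by real_asymp
  qed
  then have "c = 2 * pi * \<i>"
    unfolding c by (simp add: tendsto_const_iff)
  then show ?thesis
    unfolding c by simp
qed

text \<open>
  The arms of the contour may be turned anywhere into the left half plane, where \<open>exp (exp \<zeta>)\<close> decays
  doubly exponentially.
\<close>

lemma hankel_limit_angle:
  assumes "pi / 2 < \<theta>" "\<theta> \<le> pi"
    and "((\<lambda>V. P (Complex V pi) - P (Complex V (- pi))) \<longlongrightarrow> L) at_top"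
  shows "((\<lambda>V. P (Complex V \<theta>) - P (Complex V (- \<theta>))) \<longlongrightarrow> L) at_top"
proof -
  have neg: "cos \<theta> < 0"
    using assms cos_monotone_0_pi[of "pi/2" \<theta>] by simp
  have B: "norm (hankel_kernel z (Complex V y)) \<le> exp (exp V * cos \<theta> + (1 - z) * V)"
    if "\<theta> \<le> \<bar>y\<bar>" "\<bar>y\<bar> \<le> pi" for V y
  proof -
    have "cos y \<le> cos \<theta>"
      using that assms cos_monotone_0_pi_le[of \<theta> "\<bar>y\<bar>"] by simp
    then show ?thesis by (simp add: norm_hankel_kernel)
  qed
  have lim: "((\<lambda>V. exp (exp V * cos \<theta> + (1 - z) * V) * (pi - \<theta>)) \<longlongrightarrow> 0) at_top"
    using neg by real_asymp
  have "((\<lambda>V. P (Complex V pi) - P (Complex V \<theta>)) \<longlongrightarrow> 0) at_top"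
    using primitive_increment_vertical[OF P, of \<theta> pi] B assms
    by (intro Lim_null_comparison[OF always_eventually lim]) auto
  moreover have "((\<lambda>V. P (Complex V (-\<theta>)) - P (Complex V (-pi))) \<longlongrightarrow> 0) at_top"
    using primitive_increment_vertical[OF P, of "-pi" "-\<theta>"] B assms
    by (intro Lim_null_comparison[OF always_eventually lim]) auto
  ultimately have "((\<lambda>V. (P (Complex V pi) - P (Complex V (- pi))) - (P (Complex V pi) - P (Complex V \<theta>))
      - (P (Complex V (-\<theta>)) - P (Complex V (-pi)))) \<longlongrightarrow> L - 0 - 0) at_top"
    by (intro tendsto_diff assms)
  then show ?thesis by (simp add: algebra_simps)
qed

end

text \<open>
  Integration by parts: \<open>e^\<sigma> \<sigma>^(-w)\<close> vanishes at both ends of the contour, so its derivative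
  integrates to 0. This mirrors the functional equation \<open>\<Gamma>(w + 1) = w \<Gamma>(w)\<close>.
\<close>

lemma hankel_limit_step:
  assumes Q: "\<And>\<zeta>. (Q has_field_derivative hankel_kernel w \<zeta>) (at \<zeta>)"
    and P: "\<And>\<zeta>. (P has_field_derivative hankel_kernel (w + 1) \<zeta>) (at \<zeta>)"
    and "w \<noteq> 0" "pi / 2 < \<theta>" "\<theta> \<le> pi"
    and L: "((\<lambda>V. Q (Complex V \<theta>) - Q (Complex V (- \<theta>))) \<longlongrightarrow> L) at_top"
  shows "((\<lambda>V. P (Complex V \<theta>) - P (Complex V (- \<theta>))) \<longlongrightarrow> L / of_real w) at_top"
proof -
  define G where "G \<zeta> = exp (exp \<zeta> - of_real w * \<zeta>)" for \<zeta> :: complex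
  have "((\<lambda>\<zeta>. Q \<zeta> - of_real w * P \<zeta> - G \<zeta>) has_field_derivative 0) (at \<zeta>)" for \<zeta>
  proof -
    have G: "(G has_field_derivative G \<zeta> * (exp \<zeta> - of_real w)) (at \<zeta>)"
      unfolding G_def by (auto intro!: derivative_eq_intros)
    have "hankel_kernel w \<zeta> = G \<zeta> * exp \<zeta>" "hankel_kernel (w + 1) \<zeta> = G \<zeta>"
      by (auto simp: hankel_kernel_def G_def exp_add[symmetric] algebra_simps)
    then have "hankel_kernel w \<zeta> - of_real w * hankel_kernel (w + 1) \<zeta> - G \<zeta> * (exp \<zeta> - of_real w) = 0"
      by (simp add: algebra_simps)
    then show ?thesis
      using DERIV_diff[OF DERIV_diff[OF Q[of \<zeta>] DERIV_cmult[OF P[of \<zeta>], of "of_real w"]] G] by simp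
  qed
  then obtain c where "\<And>\<zeta>. Q \<zeta> - of_real w * P \<zeta> - G \<zeta> = c"
    using has_field_derivative_zero_constant[of UNIV "\<lambda>\<zeta>. Q \<zeta> - of_real w * P \<zeta> - G \<zeta>"] by auto
  from this[symmetric] have P_eq: "P \<zeta> = (Q \<zeta> - G \<zeta> - c) / of_real w" for \<zeta>
    using \<open>w \<noteq> 0\<close> by (simp add: field_simps)
  have neg: "cos \<theta> < 0"
    using assms cos_monotone_0_pi[of "pi/2" \<theta>] by simp
  have G: "((\<lambda>V. G (Complex V y)) \<longlongrightarrow> 0) at_top" if "y = \<theta> \<or> y = - \<theta>" for y
  proof (rule tendsto_norm_zero_cancel)
    have "cos y = cos \<theta>" using that by auto
    then have "(\<lambda>V. norm (G (Complex V y))) = (\<lambda>V. exp (exp V * cos \<theta> - w * V))"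
      by (simp add: G_def Re_exp)
    moreover have "((\<lambda>V. exp (exp V * cos \<theta> - w * V)) \<longlongrightarrow> 0) at_top"
      using neg by real_asymp
    ultimately show "((\<lambda>V. norm (G (Complex V y))) \<longlongrightarrow> 0) at_top" by simp
  qed
  have QG: "((\<lambda>V. ((Q (Complex V \<theta>) - Q (Complex V (-\<theta>))) - G (Complex V \<theta>) + G (Complex V (-\<theta>))) / of_real w)
      \<longlongrightarrow> (L - 0 + 0) / of_real w) at_top"
    using \<open>w \<noteq> 0\<close> by (intro tendsto_intros L G) auto
  then show ?thesis
    unfolding P_eq diff_divide_distrib[symmetric] by (simp add: algebra_simps)
qed

text \<open>
  Hankel's formula in terms of a primitive: the base cases are \<open>z < 1\<close> and \<open>z = 1\<close>, and
  \<open>hankel_limit_step\<close> moves upwards in unit steps.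
\<close>

lemma hankel_limit:
  assumes "\<And>\<zeta>. (P has_field_derivative hankel_kernel z \<zeta>) (at \<zeta>)" "pi / 2 < \<theta>" "\<theta> \<le> pi"
  shows "((\<lambda>V. P (Complex V \<theta>) - P (Complex V (- \<theta>))) \<longlongrightarrow> 2 * pi * \<i> * of_real (rGamma z)) at_top"
proof -
  have "((\<lambda>V. P (Complex V \<theta>) - P (Complex V (- \<theta>))) \<longlongrightarrow> 2 * pi * \<i> * of_real (rGamma z)) at_top"
    if "\<And>\<zeta>. (P has_field_derivative hankel_kernel z \<zeta>) (at \<zeta>)" "z \<le> real n + 1" for n z P
    using that
  proof (induction n arbitrary: z P)
    case (0 z P)
    show ?case
    proof (cases "z = 1")
      case True
      then show ?thesis
        using hankel_limit_angle[OF 0(1) assms(2,3) hankel_limit_at_pi_eq_1[OF 0(1)]] by simp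
    next
      case False
      then show ?thesis
        using hankel_limit_angle[OF 0(1) assms(2,3) hankel_limit_at_pi_lt_1[OF 0(1)]] 0(2) by simp
    qed
  next
    case (Suc n z P)
    show ?case
    proof (cases "z \<le> real n + 1")
      case True
      then show ?thesis using Suc.IH[OF Suc.prems(1)] by simp
    next
      case False
      define w where "w = z - 1"
      have w: "z = w + 1" "w > 0" "w \<le> real n + 1"
        using False Suc.prems by (auto simp: w_def)
      obtain Q where Q: "\<And>\<zeta>. (Q has_field_derivative hankel_kernel w \<zeta>) (at \<zeta>)"
        using hankel_primitive_exists[of w] by metis
      have "rGamma w = w * rGamma z"
        using rGamma_plus1[of w] by (simp add: w)
      then show ?thesis
        using hankel_limit_step[OF Q Suc.prems(1)[unfolded w(1)] _ assms(2,3) Suc.IH[OF Q w(3)]] w by (simp add: mult.assoc)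
    qed
  qed
  from this[OF assms(1), of "nat \<lceil>z\<rceil>"] show ?thesis
    using real_nat_ceiling_ge[of z] by simp
qed


section \<open>Hankel's integral along a parametrised contour\<close>

text \<open>
  The logarithm of the contour that comes in along the ray of argument \<open>-\<theta>\<close>, follows the arc of
  radius \<open>e^\<rho>\<close> around 0 and leaves along the ray of argument \<open>\<theta>\<close>. A single parameter \<open>u\<close> over
  the real line makes contour integrals ordinary Lebesgue integrals, to which dominated convergence and
  Fubini's theorem apply.
\<close>

definition hankel_path :: "real \<Rightarrow> real \<Rightarrow> real \<Rightarrow> complex" where
  "hankel_path \<theta> \<rho> u = Complex (\<rho> + max 0 (\<bar>u\<bar> - \<theta>)) (max (- \<theta>) (min \<theta> u))"

definition hankel_speed :: "real \<Rightarrow> real \<Rightarrow> complex" where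
  "hankel_speed \<theta> u = (if \<bar>u\<bar> < \<theta> then \<i> else of_real (sgn u))"

lemma norm_hankel_speed_le: "norm (hankel_speed \<theta> u) \<le> 1"
  by (simp add: hankel_speed_def sgn_real_def)

lemma hankel_speed_measurable [measurable]: "hankel_speed \<theta> \<in> borel_measurable borel"
  unfolding hankel_speed_def[abs_def] by measurable

lemma continuous_hankel_path [continuous_intros]: "continuous_on A (hankel_path \<theta> \<rho>)"
  unfolding hankel_path_def[abs_def] Complex_eq by (intro continuous_intros)

lemma hankel_path_measurable [measurable]: "hankel_path \<theta> \<rho> \<in> borel_measurable borel"
  by (intro borel_measurable_continuous_onI continuous_hankel_path)

lemma hankel_path_derivative:
  assumes "\<theta> > 0" "u \<noteq> \<theta>" "u \<noteq> - \<theta>"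
  shows "(hankel_path \<theta> \<rho> has_vector_derivative hankel_speed \<theta> u) (at u)"
proof -
  consider "\<bar>u\<bar> < \<theta>" | "u > \<theta>" | "u < - \<theta>" using assms by linarith
  then show ?thesis
  proof cases
    case 1
    have "((\<lambda>u. Complex \<rho> u) has_vector_derivative \<i>) (at u)"
      unfolding Complex_eq by (auto intro!: derivative_eq_intros)
    then show ?thesis
    proof (rule has_vector_derivative_transform_within_open[of _ _ _ "{-\<theta><..<\<theta>}", THEN has_vector_derivative_eq_rhs])
      show "Complex \<rho> v = hankel_path \<theta> \<rho> v" if "v \<in> {-\<theta><..<\<theta>}" for v
        using that by (auto simp: hankel_path_def complex_eq_iff)
    qed (use 1 in \<open>auto simp: hankel_speed_def\<close>)
  next
    case 2
    have "((\<lambda>u. Complex (\<rho> + (u - \<theta>)) \<theta>) has_vector_derivative 1) (at u)"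
      unfolding Complex_eq by (auto intro!: derivative_eq_intros)
    then show ?thesis
    proof (rule has_vector_derivative_transform_within_open[of _ _ _ "{\<theta><..}", THEN has_vector_derivative_eq_rhs])
      show "Complex (\<rho> + (v - \<theta>)) \<theta> = hankel_path \<theta> \<rho> v" if "v \<in> {\<theta><..}" for v
        using that assms by (auto simp: hankel_path_def complex_eq_iff)
    qed (use 2 assms in \<open>auto simp: hankel_speed_def sgn_real_def\<close>)
  next
    case 3
    have "((\<lambda>u. Complex (\<rho> + (- u - \<theta>)) (- \<theta>)) has_vector_derivative -1) (at u)"
      unfolding Complex_eq by (auto intro!: derivative_eq_intros)
    then show ?thesis
    proof (rule has_vector_derivative_transform_within_open[of _ _ _ "{..<-\<theta>}", THEN has_vector_derivative_eq_rhs])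
      show "Complex (\<rho> + (- v - \<theta>)) (- \<theta>) = hankel_path \<theta> \<rho> v" if "v \<in> {..<-\<theta>}" for v
        using that assms by (auto simp: hankel_path_def complex_eq_iff)
    qed (use 3 assms in \<open>auto simp: hankel_speed_def sgn_real_def\<close>)
  qed
qed

text \<open>
  A common majorant for all contour integrals that occur: \<open>K = 0\<close> serves Hankel's
  formula, and \<open>K = \<bar>\<xi>\<bar>\<close> dominates the partial sums of the Wright series at \<open>-\<xi>\<close>. The reason is that on the arms
  the first term of the exponent is \<open>- \<delta> e^v\<close> with \<open>\<delta> > 0\<close>, which beats \<open>K e^(\<nu> v)\<close> for \<open>\<nu> < 1\<close>.
\<close>

lemma hankel_majorant_integrable:
  fixes K c \<rho> \<nu> \<theta> :: real
  assumes "pi / 2 < \<theta>" "\<theta> \<le> pi" "0 < \<nu>" "\<nu> < 1" "0 \<le> K"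
  shows "integrable lborel (\<lambda>u. exp (Re (exp (hankel_path \<theta> \<rho> u)) + K * exp (\<nu> * Re (hankel_path \<theta> \<rho> u))
           + c * Re (hankel_path \<theta> \<rho> u)))"
proof -
  let ?f = "\<lambda>u. exp (Re (exp (hankel_path \<theta> \<rho> u)) + K * exp (\<nu> * Re (hankel_path \<theta> \<rho> u))
           + c * Re (hankel_path \<theta> \<rho> u))"
  define \<delta> where "\<delta> = - cos \<theta>"
  have "\<delta> > 0"
    using assms cos_monotone_0_pi[of "pi/2" \<theta>] by (simp add: \<delta>_def)
  \<comment> \<open>On the arms, the majorant times \<open>1 + u^2\<close> is \<open>g \<bar>u\<bar>\<close>; it tends to 0, so that \<open>1 / (1 + u^2)\<close> serves as an integrable bound.\<close>
  define g where "g x = exp (- \<delta> * exp (\<rho> + x - \<theta>) + K * exp (\<nu> * (\<rho> + x - \<theta>)) + c * (\<rho> + x - \<theta>)) * (1 + x\<^sup>2)" for x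
  have f_eq: "?f u * (1 + u\<^sup>2) = g \<bar>u\<bar>" if "\<bar>u\<bar> \<ge> \<theta>" for u
  proof -
    have "hankel_path \<theta> \<rho> u = Complex (\<rho> + \<bar>u\<bar> - \<theta>) (if u \<ge> 0 then \<theta> else - \<theta>)"
      using that assms pi_gt_zero by (auto simp: hankel_path_def complex_eq_iff)
    then show ?thesis by (simp add: g_def \<delta>_def Re_exp)
  qed
  have "(g \<longlongrightarrow> 0) at_top"
  proof (cases "K = 0")
    case True
    then show ?thesis
      unfolding g_def using \<open>\<delta> > 0\<close> by simp real_asymp
  next
    case False
    then have "K > 0" using assms by simp
    then show ?thesis
      unfolding g_def using \<open>\<delta> > 0\<close> \<open>0 < \<nu>\<close> \<open>\<nu> < 1\<close> by real_asymp
  qed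
  then have "\<forall>\<^sub>F x in at_top. g x < 1" by (rule order_tendstoD) simp
  then obtain X where X: "\<And>x. x \<ge> X \<Longrightarrow> g x \<le> 1"
    by (auto simp: eventually_at_top_linorder intro: less_imp_le)
  define Y where "Y = max X \<theta>"
  have cont: "continuous_on {-Y..Y} (\<lambda>u. ?f u * (1 + u\<^sup>2))"
    by (intro continuous_intros)
  have "compact ((\<lambda>u. ?f u * (1 + u\<^sup>2)) ` {-Y..Y})"
    by (intro compact_continuous_image cont) auto
  then obtain B where B: "\<And>u. \<bar>u\<bar> \<le> Y \<Longrightarrow> norm (?f u * (1 + u\<^sup>2)) \<le> B"
    unfolding bounded_iff[THEN arg_cong] by (force dest!: compact_imp_bounded simp: bounded_iff abs_le_iff)
  have bound: "?f u \<le> max 1 B * inverse (1 + u\<^sup>2)" for u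
  proof -
    have pos: "1 + u\<^sup>2 > 0" by (simp add: add_pos_nonneg)
    have "?f u * (1 + u\<^sup>2) \<le> max 1 B"
    proof (cases "\<bar>u\<bar> \<le> Y")
      case True
      from abs_le_D1[OF B[OF True, unfolded real_norm_def]] show ?thesis by (simp add: max.coboundedI2)
    next
      case False
      then have "?f u * (1 + u\<^sup>2) = g \<bar>u\<bar>" "g \<bar>u\<bar> \<le> 1"
        using X[of "\<bar>u\<bar>"] by (auto simp: Y_def intro!: f_eq)
      then show ?thesis by linarith
    qed
    with pos show ?thesis by (simp add: field_simps)
  qed
  have "integrable lborel (\<lambda>u::real. inverse (1 + u\<^sup>2))"
    using integrable_inverse_1_plus_square by (simp add: set_integrable_def)
  then have "integrable lborel (\<lambda>u::real. max 1 B * inverse (1 + u\<^sup>2))"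
    by (rule integrable_mult_right)
  then show ?thesis
    by (rule Bochner_Integration.integrable_bound)
       (use bound in \<open>auto intro!: AE_I2 order.trans[OF bound]\<close>)
qed

lemma hankel_integral:
  assumes "pi / 2 < \<theta>" "\<theta> \<le> pi"
  shows "integrable lborel (\<lambda>u. hankel_kernel z (hankel_path \<theta> \<rho> u) * hankel_speed \<theta> u)"
    and "(LBINT u. hankel_kernel z (hankel_path \<theta> \<rho> u) * hankel_speed \<theta> u) = 2 * pi * \<i> * of_real (rGamma z)"
proof -
  let ?f = "\<lambda>u. hankel_kernel z (hankel_path \<theta> \<rho> u) * hankel_speed \<theta> u"
  have [measurable]: "hankel_kernel z \<in> borel_measurable borel"
    unfolding hankel_kernel_def[abs_def] by measurable
  have pos: "\<theta> > 0" using assms pi_gt_zero by linarith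
  show int: "integrable lborel ?f"
  proof (rule Bochner_Integration.integrable_bound)
    show "integrable lborel (\<lambda>u. exp (Re (exp (hankel_path \<theta> \<rho> u)) + 0 * exp ((1/2) * Re (hankel_path \<theta> \<rho> u))
           + (1 - z) * Re (hankel_path \<theta> \<rho> u)))"
      by (rule hankel_majorant_integrable) (use assms in auto)
    show "AE u in lborel. norm (?f u) \<le> norm (exp (Re (exp (hankel_path \<theta> \<rho> u)) + 0 * exp ((1/2) * Re (hankel_path \<theta> \<rho> u))
           + (1 - z) * Re (hankel_path \<theta> \<rho> u)))"
      using norm_hankel_speed_le
      by (intro AE_I2) (simp add: norm_mult norm_hankel_kernel Re_exp mult_left_le)
  qed measurable
  obtain P where P: "\<And>\<zeta>. (P has_field_derivative hankel_kernel z \<zeta>) (at \<zeta>)"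
    using hankel_primitive_exists[of z] by metis
  have "integral {-U..U} ?f = P (Complex (\<rho> + U - \<theta>) \<theta>) - P (Complex (\<rho> + U - \<theta>) (- \<theta>))" if "U \<ge> \<theta>" for U
  proof -
    have "(?f has_integral P (hankel_path \<theta> \<rho> U) - P (hankel_path \<theta> \<rho> (- U))) {-U..U}"
    proof (rule fundamental_theorem_of_calculus_interior_strong[of "{\<theta>, -\<theta>}"])
      show "((\<lambda>u. P (hankel_path \<theta> \<rho> u)) has_vector_derivative ?f u) (at u)"
        if "u \<in> {-U<..<U} - {\<theta>, -\<theta>}" for u
      proof -
        have "(hankel_path \<theta> \<rho> has_vector_derivative hankel_speed \<theta> u) (at u within UNIV)"
          using hankel_path_derivative[OF pos] that by auto
        from field_vector_diff_chain_within[OF this has_field_derivative_at_within[OF P]]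
        show ?thesis by (simp add: o_def mult.commute)
      qed
      have "continuous_on UNIV P"
        using P DERIV_isCont by (auto intro!: continuous_at_imp_continuous_on)
      then show "continuous_on {-U..U} (\<lambda>u. P (hankel_path \<theta> \<rho> u))"
        by (rule continuous_on_compose2) (auto intro: continuous_hankel_path)
    qed (use that pos in auto)
    moreover have "hankel_path \<theta> \<rho> U = Complex (\<rho> + U - \<theta>) \<theta>" "hankel_path \<theta> \<rho> (- U) = Complex (\<rho> + U - \<theta>) (- \<theta>)"
      using that pos by (auto simp: hankel_path_def)
    ultimately show ?thesis by (simp add: integral_unique)
  qed
  then have ev: "\<forall>\<^sub>F U in at_top. P (Complex (\<rho> + U - \<theta>) \<theta>) - P (Complex (\<rho> + U - \<theta>) (- \<theta>)) = integral {-U..U} ?f"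
    by (intro eventually_mono[OF eventually_ge_at_top[of \<theta>]]) simp
  have "((\<lambda>U. P (Complex (\<rho> + U - \<theta>) \<theta>) - P (Complex (\<rho> + U - \<theta>) (- \<theta>))) \<longlongrightarrow> 2 * pi * \<i> * of_real (rGamma z)) at_top"
    by (rule filterlim_compose[OF hankel_limit[OF P assms]]) real_asymp
  from Lim_transform_eventually[OF this ev] truncated_integral_tendsto[OF int]
  show "(LBINT u. ?f u) = 2 * pi * \<i> * of_real (rGamma z)"
    by (intro tendsto_unique[of at_top]) auto
qed


section \<open>The Laplace transform of the Wright density\<close>

lemma sums_integral_dominated:
  fixes f :: "nat \<Rightarrow> 'a \<Rightarrow> 'b::{banach, second_countable_topology}"
  assumes f: "\<And>n. integrable M (f n)" and w: "integrable M w"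
    and [measurable]: "g \<in> borel_measurable M"
    and sums: "\<And>x. (\<lambda>n. f n x) sums g x"
    and bound: "\<And>n x. norm (\<Sum>i<n. f i x) \<le> w x"
  shows "integrable M g" "(\<lambda>n. integral\<^sup>L M (f n)) sums integral\<^sup>L M g"
proof -
  have [measurable]: "f n \<in> borel_measurable M" for n using f by auto
  have lim: "AE x in M. (\<lambda>n. \<Sum>i<n. f i x) \<longlonglongrightarrow> g x"
    using sums by (auto simp: sums_def)
  show "integrable M g"
    by (rule integrable_dominated_convergence[OF _ _ w lim]) (use bound in auto)
  have "(\<lambda>n. \<integral>x. (\<Sum>i<n. f i x) \<partial>M) \<longlonglongrightarrow> integral\<^sup>L M g"
    by (rule integral_dominated_convergence[OF _ _ w lim]) (use bound in auto)
  then show "(\<lambda>n. integral\<^sup>L M (f n)) sums integral\<^sup>L M g"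
    using f by (simp add: sums_def Bochner_Integration.integral_sum)
qed

lemma complex_exp_half_line_integral:
  assumes "Re w > 0"
  shows "set_integrable lborel {0<..} (\<lambda>x. exp (- (of_real x * w)))"
    and "(LBINT x:{0<..}. exp (- (of_real x * w))) = 1 / w"
proof -
  show int: "set_integrable lborel {0<..} (\<lambda>x. exp (- (of_real x * w)))"
  proof (rule set_integrable_bound)
    show "set_integrable lborel {0<..} (\<lambda>x. exp (- (x * Re w)))"
      using integrable_I0i_exp_mscale[OF assms]
      by (simp add: set_integrable_def einterval_def greaterThan_def)
    show "set_borel_measurable lborel {0<..} (\<lambda>x. exp (- (complex_of_real x * w)))"
      unfolding set_borel_measurable_def by measurable
  qed auto
  have "(LBINT x=0..\<infinity>. exp (- (of_real x * w))) = 0 - (- 1 / w)"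
  proof (rule interval_integral_FTC_integrable[where F = "\<lambda>x. - exp (- (of_real x * w)) / w"])
    have w0: "w \<noteq> 0" using assms by auto
    show "((\<lambda>x. - exp (- (complex_of_real x * w)) / w) has_vector_derivative exp (- (of_real x * w))) (at x)" for x
    proof -
      have "((\<lambda>z. - exp (- (z * w)) / w) has_field_derivative exp (- (of_real x * w))) (at (of_real x))"
        using w0 by (auto intro!: derivative_eq_intros)
      from has_vector_derivative_real_field[OF this] show ?thesis .
    qed
    show "set_integrable lborel (einterval 0 \<infinity>) (\<lambda>x. exp (- (complex_of_real x * w)))"
      using int by (simp add: einterval_def greaterThan_def zero_ereal_def)
    show "(((\<lambda>x. - exp (- (complex_of_real x * w)) / w) \<circ> real_of_ereal) \<longlongrightarrow> - 1 / w) (at_right 0)"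
      unfolding zero_ereal_def ereal_tendsto_simps1
      by (auto intro!: tendsto_eq_intros simp: w0)
    show "(((\<lambda>x. - exp (- (complex_of_real x * w)) / w) \<circ> real_of_ereal) \<longlongrightarrow> 0) (at_left \<infinity>)"
      unfolding ereal_tendsto_simps1
    proof (rule tendsto_norm_zero_cancel)
      have "((\<lambda>x. exp (- (x * Re w)) / norm w) \<longlongrightarrow> 0) at_top"
        using assms w0 by real_asymp
      then show "((\<lambda>x. norm (- exp (- (complex_of_real x * w)) / w)) \<longlongrightarrow> 0) at_top"
        by (simp add: norm_divide)
    qed
  qed (auto intro!: continuous_intros)
  then show "(LBINT x:{0<..}. exp (- (of_real x * w))) = 1 / w"
    by (simp add: interval_lebesgue_integral_def einterval_def greaterThan_def zero_ereal_def)
qed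

lemma norm_exp_partial_sum_le:
  fixes x :: complex
  shows "norm (\<Sum>r<n. x ^ r / fact r) \<le> exp (norm x)"
proof -
  have "norm (\<Sum>r<n. x ^ r / fact r) \<le> (\<Sum>r<n. norm x ^ r / fact r)"
    by (rule norm_sum[THEN order.trans]) (simp add: norm_divide norm_power)
  also have "\<dots> \<le> exp (norm x)"
  proof -
    have sums: "(\<lambda>r. norm x ^ r / fact r) sums exp (norm x)"
      using exp_converges[of "norm x"] by (simp add: divide_inverse mult.commute)
    show ?thesis
      unfolding sums_unique[OF sums] by (rule sum_le_suminf[OF sums_summable[OF sums]]) auto
  qed
  finally show ?thesis .
qed

context
  fixes \<nu> \<theta> \<rho> :: real
  assumes \<nu>: "0 < \<nu>" "\<nu> < 1" and \<theta>: "pi / 2 < \<theta>" "\<theta> \<le> pi" "\<nu> * \<theta> < pi / 2"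
begin

text \<open>
  Each coefficient of the Wright series is replaced by its Hankel integral; the series under the
  integral sign is then the exponential series.
\<close>

lemma wright_hankel_sums:
  "(\<lambda>r. complex_of_real ((- \<xi>) ^ r / fact r * rGamma (- \<nu> * real r + (1 - \<nu>)))) sums
     ((LBINT u. exp (exp (hankel_path \<theta> \<rho> u) + of_real \<nu> * hankel_path \<theta> \<rho> u
        - of_real \<xi> * exp (of_real \<nu> * hankel_path \<theta> \<rho> u)) * hankel_speed \<theta> u) / (2 * pi * \<i>))"
proof -
  let ?\<zeta> = "hankel_path \<theta> \<rho>"
  define k where "k r u = hankel_kernel (1 - \<nu> - \<nu> * real r) (?\<zeta> u) * hankel_speed \<theta> u" for r u
  define f where "f r u = of_real ((- \<xi>) ^ r / fact r) * k r u" for r u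
  let ?g = "\<lambda>u. exp (exp (?\<zeta> u) + of_real \<nu> * ?\<zeta> u - of_real \<xi> * exp (of_real \<nu> * ?\<zeta> u)) * hankel_speed \<theta> u"
  have f_eq: "f r u = (exp (exp (?\<zeta> u) + of_real \<nu> * ?\<zeta> u) * hankel_speed \<theta> u) *
      ((- (of_real \<xi> * exp (of_real \<nu> * ?\<zeta> u))) ^ r / fact r)" for r u
  proof -
    have "hankel_kernel (1 - \<nu> - \<nu> * real r) (?\<zeta> u) =
        exp (exp (?\<zeta> u) + of_real \<nu> * ?\<zeta> u) * exp (of_real \<nu> * ?\<zeta> u) ^ r"
      by (simp add: hankel_kernel_def exp_of_nat_mult[symmetric] exp_add[symmetric] algebra_simps)
    moreover have "(- (complex_of_real \<xi> * y)) ^ r = (- of_real \<xi>) ^ r * y ^ r" for y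
      by (simp add: power_mult_distrib[symmetric])
    ultimately show ?thesis
      by (simp add: f_def k_def)
  qed
  have "(\<lambda>r. integral\<^sup>L lborel (f r)) sums integral\<^sup>L lborel ?g"
  proof (rule sums_integral_dominated(2))
    show "integrable lborel (f r)" for r
      unfolding f_def k_def by (intro integrable_mult_right hankel_integral \<theta>)
    show "integrable lborel (\<lambda>u. exp (Re (exp (?\<zeta> u)) + \<bar>\<xi>\<bar> * exp (\<nu> * Re (?\<zeta> u)) + \<nu> * Re (?\<zeta> u)))"
      using \<nu> \<theta> by (intro hankel_majorant_integrable) auto
    show "(\<lambda>r. f r u) sums ?g u" for u
    proof -
      have "(\<lambda>r. (- (of_real \<xi> * exp (of_real \<nu> * ?\<zeta> u))) ^ r / fact r) sums
          exp (- (of_real \<xi> * exp (of_real \<nu> * ?\<zeta> u)))"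
        using exp_converges[of "- (of_real \<xi> * exp (of_real \<nu> * ?\<zeta> u))"]
        by (simp add: scaleR_conv_of_real divide_inverse mult.commute)
      from sums_mult[OF this, of "exp (exp (?\<zeta> u) + of_real \<nu> * ?\<zeta> u) * hankel_speed \<theta> u"]
      show ?thesis
        unfolding f_eq by (simp add: exp_diff exp_minus divide_inverse mult_ac)
    qed
    show "norm (\<Sum>i<n. f i u) \<le> exp (Re (exp (?\<zeta> u)) + \<bar>\<xi>\<bar> * exp (\<nu> * Re (?\<zeta> u)) + \<nu> * Re (?\<zeta> u))" for n u
    proof -
      have "norm (\<Sum>i<n. f i u) = exp (Re (exp (?\<zeta> u)) + \<nu> * Re (?\<zeta> u)) * norm (hankel_speed \<theta> u) *
          norm (\<Sum>r<n. (- (of_real \<xi> * exp (of_real \<nu> * ?\<zeta> u))) ^ r / fact r)"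
        unfolding f_eq sum_distrib_left[symmetric] by (simp add: norm_mult)
      also have "\<dots> \<le> exp (Re (exp (?\<zeta> u)) + \<nu> * Re (?\<zeta> u)) * 1 * exp (\<bar>\<xi>\<bar> * exp (\<nu> * Re (?\<zeta> u)))"
        using norm_exp_partial_sum_le[of "- (of_real \<xi> * exp (of_real \<nu> * ?\<zeta> u))" n]
        by (intro mult_mono) (auto simp: norm_mult norm_hankel_speed_le)
      finally show ?thesis by (simp add: exp_add mult_ac)
    qed
  qed measurable
  moreover have "integral\<^sup>L lborel (f r) =
      complex_of_real ((- \<xi>) ^ r / fact r * rGamma (- \<nu> * real r + (1 - \<nu>))) * (2 * pi * \<i>)" for r
    unfolding f_def k_def integral_mult_right_zero hankel_integral(2)[OF \<theta>(1,2)]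
    by (simp add: algebra_simps)
  ultimately have "(\<lambda>r. complex_of_real ((- \<xi>) ^ r / fact r * rGamma (- \<nu> * real r + (1 - \<nu>))) * (2 * pi * \<i>))
      sums integral\<^sup>L lborel ?g"
    by simp
  from sums_divide[OF this, of "2 * pi * \<i>"] show ?thesis
    by simp
qed

lemma wright_hankel:
  "(LBINT u. exp (exp (hankel_path \<theta> \<rho> u) + of_real \<nu> * hankel_path \<theta> \<rho> u
        - of_real \<xi> * exp (of_real \<nu> * hankel_path \<theta> \<rho> u)) * hankel_speed \<theta> u) =
    2 * pi * \<i> * of_real (wright (- \<nu>) (1 - \<nu>) (- \<xi>))"
proof -
  have "summable (\<lambda>r. (- \<xi>) ^ r / fact r * rGamma (- \<nu> * real r + (1 - \<nu>)))"
    using sums_summable[OF wright_hankel_sums[of \<xi>]] by (simp only: summable_complex_of_real)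
  then have "(\<lambda>r. complex_of_real ((- \<xi>) ^ r / fact r * rGamma (- \<nu> * real r + (1 - \<nu>))))
      sums of_real (wright (- \<nu>) (1 - \<nu>) (- \<xi>))"
    unfolding wright_def by (intro sums_of_real summable_sums)
  from sums_unique2[OF this wright_hankel_sums] show ?thesis
    by (simp add: field_simps)
qed

text \<open>
  This is where \<open>\<nu> \<theta> < \<pi>/2\<close> enters: \<open>\<sigma>^\<nu>\<close> stays in a sector inside the right half plane, so
  \<open>e^(- \<xi> \<sigma>^\<nu>)\<close> is integrable over \<open>\<xi> > 0\<close>, even without a factor \<open>e^(- s \<xi>)\<close>.
\<close>

lemma cos_angle_lower:
  shows "cos (\<nu> * \<theta>) > 0" and "Re (exp (of_real \<nu> * hankel_path \<theta> \<rho> u)) \<ge> cos (\<nu> * \<theta>) * exp (\<nu> * Re (hankel_path \<theta> \<rho> u))"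
proof -
  have \<theta>0: "0 < \<theta>" using \<theta> pi_gt_zero by linarith
  show "cos (\<nu> * \<theta>) > 0"
    using \<nu> \<theta> \<theta>0 mult_pos_pos[OF \<nu>(1) \<theta>0] by (intro cos_gt_zero_pi) linarith+
  have "\<bar>Im (hankel_path \<theta> \<rho> u)\<bar> \<le> \<theta>" using \<theta>0 by (auto simp: hankel_path_def)
  then have "\<bar>\<nu> * Im (hankel_path \<theta> \<rho> u)\<bar> \<le> \<nu> * \<theta>"
    using \<nu> by (simp add: abs_mult)
  then have "cos (\<nu> * \<theta>) \<le> cos \<bar>\<nu> * Im (hankel_path \<theta> \<rho> u)\<bar>"
    using \<theta>(3) pi_gt_zero by (intro cos_monotone_0_pi_le) linarith+
  then show "Re (exp (of_real \<nu> * hankel_path \<theta> \<rho> u)) \<ge> cos (\<nu> * \<theta>) * exp (\<nu> * Re (hankel_path \<theta> \<rho> u))"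
    by (simp add: Re_exp mult.commute)
qed

text \<open>
  Fubini's theorem applied to the contour representation of the density. After the integration over
  \<open>\<xi>\<close>, the factor \<open>1 / Re (s + \<sigma>^\<nu>)\<close> is at most a constant times \<open>\<bar>\<sigma>\<bar>^(-\<nu>)\<close>, which cancels the growth of \<open>\<sigma>^\<nu>\<close>.
\<close>

lemma wright_laplace_hankel:
  assumes "s \<ge> 0"
  defines "L \<equiv> (LBINT u. exp (exp (hankel_path \<theta> \<rho> u) + of_real \<nu> * hankel_path \<theta> \<rho> u)
       / (of_real s + exp (of_real \<nu> * hankel_path \<theta> \<rho> u)) * hankel_speed \<theta> u)"
  shows "set_integrable lborel {0<..} (\<lambda>\<xi>. exp (- (s * \<xi>)) * wright (- \<nu>) (1 - \<nu>) (- \<xi>))" (is ?int)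
    and "2 * pi * \<i> * of_real (LBINT \<xi>:{0<..}. exp (- (s * \<xi>)) * wright (- \<nu>) (1 - \<nu>) (- \<xi>)) = L" (is ?eq)
proof -
  let ?\<zeta> = "hankel_path \<theta> \<rho>"
  define A where "A u = exp (exp (?\<zeta> u) + of_real \<nu> * ?\<zeta> u) * hankel_speed \<theta> u" for u
  define w where "w u = of_real s + exp (of_real \<nu> * ?\<zeta> u)" for u
  have [measurable]: "A \<in> borel_measurable borel" "w \<in> borel_measurable borel"
    unfolding A_def[abs_def] w_def[abs_def] by measurable
  define F where "F = (\<lambda>(u, \<xi>). indicat_real {0<..} \<xi> *\<^sub>R (A u * exp (- (of_real \<xi> * w u))))"
  have w: "Re (w u) \<ge> cos (\<nu> * \<theta>) * exp (\<nu> * Re (?\<zeta> u))" "Re (w u) > 0" for u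
  proof -
    show *: "Re (w u) \<ge> cos (\<nu> * \<theta>) * exp (\<nu> * Re (?\<zeta> u))"
      using assms(1) cos_angle_lower(2)[of u] by (simp add: w_def)
    show "Re (w u) > 0"
      by (rule less_le_trans[OF _ *]) (simp add: cos_angle_lower(1))
  qed
  have norm_A: "norm (A u) \<le> exp (Re (exp (?\<zeta> u)) + \<nu> * Re (?\<zeta> u))" for u
    using norm_hankel_speed_le[of \<theta> u] by (simp add: A_def norm_mult mult_left_le)
  have inner: "integrable lborel (\<lambda>\<xi>. F (u, \<xi>))" "(LBINT \<xi>. F (u, \<xi>)) = A u / w u" for u
  proof -
    have "set_integrable lborel {0<..} (\<lambda>\<xi>. A u * exp (- (of_real \<xi> * w u)))"
      by (intro set_integrable_mult_right complex_exp_half_line_integral w)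
    then show "integrable lborel (\<lambda>\<xi>. F (u, \<xi>))" by (simp add: F_def set_integrable_def)
    have "(LBINT \<xi>. F (u, \<xi>)) = (LBINT \<xi>:{0<..}. A u * exp (- (of_real \<xi> * w u)))"
      unfolding F_def set_lebesgue_integral_def by (simp only: prod.case)
    also have "\<dots> = A u * (1 / w u)"
      by (simp only: set_integral_mult_right complex_exp_half_line_integral[OF w(2)])
    finally show "(LBINT \<xi>. F (u, \<xi>)) = A u / w u" by simp
  qed
  \<comment> \<open>The modulus of the integrand is an exponential with the real rate \<open>Re (w u)\<close>, so the same formula applies.\<close>
  have norm_inner: "(LBINT \<xi>. norm (F (u, \<xi>))) = norm (A u) / Re (w u)" for u
  proof -
    have "complex_of_real (LBINT \<xi>. norm (F (u, \<xi>))) =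
        (LBINT \<xi>:{0<..}. of_real (norm (A u)) * exp (- (of_real \<xi> * of_real (Re (w u)))))"
      unfolding integral_complex_of_real[symmetric] set_lebesgue_integral_def
      by (intro Bochner_Integration.integral_cong)
         (auto simp: F_def norm_mult indicator_def exp_of_real[symmetric])
    also have "\<dots> = of_real (norm (A u) / Re (w u))"
      by (subst set_integral_mult_right, subst complex_exp_half_line_integral) (use w in auto)
    finally show ?thesis
      by (simp only: of_real_eq_iff)
  qed
  have F_int: "integrable (lborel \<Otimes>\<^sub>M lborel) F"
  proof (rule lborel_pair.Fubini_integrable)
    show "F \<in> borel_measurable (lborel \<Otimes>\<^sub>M lborel)"
      unfolding F_def by measurable
    show "AE u in lborel. integrable lborel (\<lambda>\<xi>. F (u, \<xi>))"
      using inner by simp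
    show "integrable lborel (\<lambda>u. LBINT \<xi>. norm (F (u, \<xi>)))"
      unfolding norm_inner
    proof (rule Bochner_Integration.integrable_bound)
      show "integrable lborel (\<lambda>u. exp (Re (exp (?\<zeta> u)) + 0 * exp (\<nu> * Re (?\<zeta> u)) + 0 * Re (?\<zeta> u)) / cos (\<nu> * \<theta>))"
        using \<nu> \<theta> by (intro integrable_divide hankel_majorant_integrable) auto
      show "AE u in lborel. norm (norm (A u) / Re (w u)) \<le>
          norm (exp (Re (exp (?\<zeta> u)) + 0 * exp (\<nu> * Re (?\<zeta> u)) + 0 * Re (?\<zeta> u)) / cos (\<nu> * \<theta>))"
      proof (rule AE_I2)
        fix u
        have "norm (A u) / Re (w u) \<le> exp (Re (exp (?\<zeta> u)) + \<nu> * Re (?\<zeta> u)) / (cos (\<nu> * \<theta>) * exp (\<nu> * Re (?\<zeta> u)))"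
          using norm_A w cos_angle_lower(1) by (intro frac_le) auto
        also have "\<dots> = exp (Re (exp (?\<zeta> u))) / cos (\<nu> * \<theta>)"
          by (simp add: exp_add)
        finally show "norm (norm (A u) / Re (w u)) \<le>
            norm (exp (Re (exp (?\<zeta> u)) + 0 * exp (\<nu> * Re (?\<zeta> u)) + 0 * Re (?\<zeta> u)) / cos (\<nu> * \<theta>))"
          using w(2)[of u] cos_angle_lower(1) by simp
      qed
    qed measurable
  qed
  have outer: "(LBINT u. F (u, \<xi>)) =
      2 * pi * \<i> * of_real (indicat_real {0<..} \<xi> *\<^sub>R (exp (- (s * \<xi>)) * wright (- \<nu>) (1 - \<nu>) (- \<xi>)))" for \<xi>
  proof -
    have split: "exp a * h * exp (- (x * (c + E))) = exp (- (c * x)) * (exp (a - x * E) * h)"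
      for a h x c E :: complex
    proof -
      have "exp (- (x * (c + E))) = exp (- (c * x)) * exp (- (x * E))"
        by (simp add: exp_add[symmetric] algebra_simps)
      moreover have "exp (a - x * E) = exp a * exp (- (x * E))"
        by (simp add: exp_add[symmetric])
      ultimately show ?thesis by (simp only: mult_ac)
    qed
    have "F (u, \<xi>) = of_real (indicat_real {0<..} \<xi> * exp (- (s * \<xi>))) *
        (exp (exp (?\<zeta> u) + of_real \<nu> * ?\<zeta> u - of_real \<xi> * exp (of_real \<nu> * ?\<zeta> u)) * hankel_speed \<theta> u)" for u
      unfolding F_def A_def w_def prod.case split
      by (simp add: scaleR_conv_of_real exp_of_real[symmetric] mult.assoc)
    then show ?thesis
      by (simp add: wright_hankel)
  qed
  have "integrable lborel (\<lambda>\<xi>. LBINT u. F (u, \<xi>))"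
    using lborel_pair.integrable_snd[of "\<lambda>u \<xi>. F (u, \<xi>)"] F_int by simp
  then have "integrable lborel (\<lambda>\<xi>. (LBINT u. F (u, \<xi>)) / (2 * pi * \<i>))"
    by (rule integrable_divide)
  then have int: "integrable lborel (\<lambda>\<xi>. complex_of_real (indicat_real {0<..} \<xi> *\<^sub>R (exp (- (s * \<xi>)) * wright (- \<nu>) (1 - \<nu>) (- \<xi>))))"
    unfolding outer by simp
  then show ?int
    unfolding set_integrable_def using integrable_Re[OF int] by simp
  have "(LBINT \<xi>. LBINT u. F (u, \<xi>)) = (LBINT u. LBINT \<xi>. F (u, \<xi>))"
    using lborel_pair.Fubini_integral[of "\<lambda>u \<xi>. F (u, \<xi>)"] F_int by simp
  also have "\<dots> = L"
    unfolding inner(2) L_def A_def w_def by simp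
  finally show ?eq
    unfolding outer set_lebesgue_integral_def integral_mult_right_zero integral_complex_of_real .
qed

text \<open>
  The radius \<open>e^\<rho>\<close> of the arc is large enough for \<open>\<bar>s / \<sigma>^\<nu>\<bar> \<le> 1/2\<close> on the whole contour. Then
  \<open>1 / (s + \<sigma>^\<nu>)\<close> expands into a geometric series, the \<open>n\<close>-th term of which is the Hankel kernel for
  \<open>z = 1 + n \<nu>\<close>.
\<close>

lemma hankel_geometric_sums:
  assumes "s \<ge> 0" "2 * s \<le> exp (\<nu> * \<rho>)"
  shows "(\<lambda>n. 2 * pi * \<i> * of_real ((- s) ^ n * rGamma (1 + \<nu> * real n))) sums
    (LBINT u. exp (exp (hankel_path \<theta> \<rho> u) + of_real \<nu> * hankel_path \<theta> \<rho> u)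
       / (of_real s + exp (of_real \<nu> * hankel_path \<theta> \<rho> u)) * hankel_speed \<theta> u)"
proof -
  let ?\<zeta> = "hankel_path \<theta> \<rho>"
  define f where "f n u = of_real ((- s) ^ n) * (hankel_kernel (1 + \<nu> * real n) (?\<zeta> u) * hankel_speed \<theta> u)" for n u
  define q where "q u = - (of_real s * exp (- (of_real \<nu> * ?\<zeta> u)))" for u
  have f_eq: "f n u = exp (exp (?\<zeta> u)) * hankel_speed \<theta> u * q u ^ n" for n u
  proof -
    have "hankel_kernel (1 + \<nu> * real n) (?\<zeta> u) = exp (exp (?\<zeta> u)) * exp (- (of_real \<nu> * ?\<zeta> u)) ^ n"
      by (simp add: hankel_kernel_def exp_of_nat_mult[symmetric] exp_add[symmetric] algebra_simps)
    moreover have "(- (complex_of_real s * y)) ^ n = (- of_real s) ^ n * y ^ n" for y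
      by (simp add: power_mult_distrib[symmetric])
    ultimately show ?thesis by (simp add: f_def q_def)
  qed
  have q: "norm (q u) \<le> 1 / 2" for u
  proof -
    have "exp (\<nu> * \<rho>) \<le> exp (\<nu> * Re (?\<zeta> u))" using \<nu> by (simp add: hankel_path_def)
    then have "2 * s \<le> exp (\<nu> * Re (?\<zeta> u))"
      using assms(2) by linarith
    then have "s * exp (- (\<nu> * Re (?\<zeta> u))) \<le> 1 / 2"
      by (simp add: exp_minus field_simps)
    moreover have "norm (q u) = s * exp (- (\<nu> * Re (?\<zeta> u)))"
      using assms(1) by (simp add: q_def norm_mult)
    ultimately show ?thesis by simp
  qed
  have geom: "(\<lambda>n. q u ^ n) sums (1 / (1 - q u))" for u
    using q[of u] by (intro geometric_sums) linarith
  have "(\<lambda>n. integral\<^sup>L lborel (f n)) sums (LBINT u. exp (exp (?\<zeta> u)) * hankel_speed \<theta> u * (1 / (1 - q u)))"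
  proof (rule sums_integral_dominated(2))
    show "integrable lborel (f r)" for r
      unfolding f_def by (intro integrable_mult_right hankel_integral \<theta>)
    show "integrable lborel (\<lambda>u. exp (Re (exp (?\<zeta> u)) + 0 * exp (\<nu> * Re (?\<zeta> u)) + 0 * Re (?\<zeta> u)) * 2)"
      using \<nu> \<theta> by (intro integrable_mult_left hankel_majorant_integrable) auto
    show "(\<lambda>n. f n u) sums (exp (exp (?\<zeta> u)) * hankel_speed \<theta> u * (1 / (1 - q u)))" for u
      unfolding f_eq by (intro sums_mult geom)
    show "norm (\<Sum>i<n. f i u) \<le> exp (Re (exp (?\<zeta> u)) + 0 * exp (\<nu> * Re (?\<zeta> u)) + 0 * Re (?\<zeta> u)) * 2" for n u
    proof -
      have "norm (\<Sum>i<n. q u ^ i) \<le> (\<Sum>i<n. (1 / 2) ^ i)"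
        using q[of u] by (intro order.trans[OF norm_sum] sum_mono) (simp add: norm_power power_mono)
      also have "\<dots> \<le> 2"
        by (simp add: sum_gp_strict)
      finally have "norm (\<Sum>i<n. q u ^ i) \<le> 2" .
      then show ?thesis
        unfolding f_eq sum_distrib_left[symmetric] norm_mult
        by (intro mult_mono) (auto simp: norm_hankel_speed_le mult_left_le)
    qed
  qed (unfold q_def, measurable)
  moreover have "integral\<^sup>L lborel (f n) = 2 * pi * \<i> * of_real ((- s) ^ n * rGamma (1 + \<nu> * real n))" for n
    unfolding f_def integral_mult_right_zero hankel_integral(2)[OF \<theta>(1,2)] by simp
  moreover have "exp (exp (?\<zeta> u)) * hankel_speed \<theta> u * (1 / (1 - q u)) =
      exp (exp (?\<zeta> u) + of_real \<nu> * ?\<zeta> u) / (of_real s + exp (of_real \<nu> * ?\<zeta> u)) * hankel_speed \<theta> u" for u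
  proof -
    have "of_real s + exp (of_real \<nu> * ?\<zeta> u) = exp (of_real \<nu> * ?\<zeta> u) * (1 - q u)"
    proof -
      have "exp (of_real \<nu> * ?\<zeta> u) * exp (- (of_real \<nu> * ?\<zeta> u)) = 1"
        by (simp add: exp_minus)
      moreover have "exp (of_real \<nu> * ?\<zeta> u) * (1 - q u) =
          exp (of_real \<nu> * ?\<zeta> u) + of_real s * (exp (of_real \<nu> * ?\<zeta> u) * exp (- (of_real \<nu> * ?\<zeta> u)))"
        by (simp add: q_def algebra_simps)
      ultimately show ?thesis by simp
    qed
    then show ?thesis by (simp only: exp_add) simp
  qed
  ultimately show ?thesis by simp
qed

end

text \<open>
  The choice \<open>\<theta> = \<pi> / (1 + \<nu>)\<close> lies between \<open>\<pi>/2\<close> and \<open>\<pi>/(2 \<nu>)\<close>.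
\<close>

lemma wright_laplace:
  assumes "0 < \<nu>" "\<nu> < 1" "s \<ge> 0"
  shows "set_integrable lborel {0<..} (\<lambda>\<xi>. exp (- (s * \<xi>)) * wright (- \<nu>) (1 - \<nu>) (- \<xi>))"
    and "(\<lambda>n. (- s) ^ n * rGamma (1 + \<nu> * real n)) sums
           (LBINT \<xi>:{0<..}. exp (- (s * \<xi>)) * wright (- \<nu>) (1 - \<nu>) (- \<xi>))"
proof -
  define \<theta> where "\<theta> = pi / (1 + \<nu>)"
  have \<theta>: "pi / 2 < \<theta>" "\<theta> \<le> pi" "\<nu> * \<theta> < pi / 2"
    using assms by (auto simp: \<theta>_def field_simps)
  \<comment> \<open>The term \<open>+ 1\<close> keeps the logarithm defined at \<open>s = 0\<close>.\<close>
  define \<rho> where "\<rho> = ln (2 * s + 1) / \<nu>"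
  have "2 * s \<le> exp (\<nu> * \<rho>)" using assms by (simp add: \<rho>_def)
  note sums = hankel_geometric_sums[OF assms(1,2) \<theta> assms(3) this]
  show "set_integrable lborel {0<..} (\<lambda>\<xi>. exp (- (s * \<xi>)) * wright (- \<nu>) (1 - \<nu>) (- \<xi>))"
    using wright_laplace_hankel(1)[OF assms(1,2) \<theta> assms(3)] .
  from sums_divide[OF sums, of "2 * pi * \<i>"]
  have "(\<lambda>n. complex_of_real ((- s) ^ n * rGamma (1 + \<nu> * real n))) sums
      of_real (LBINT \<xi>:{0<..}. exp (- (s * \<xi>)) * wright (- \<nu>) (1 - \<nu>) (- \<xi>))"
    unfolding wright_laplace_hankel(2)[OF assms(1,2) \<theta> assms(3), symmetric] by simp
  then show "(\<lambda>n. (- s) ^ n * rGamma (1 + \<nu> * real n)) sums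
           (LBINT \<xi>:{0<..}. exp (- (s * \<xi>)) * wright (- \<nu>) (1 - \<nu>) (- \<xi>))"
    by (simp only: sums_of_real_iff)
qed

text \<open>
  The density of \<open>\<Xi>\<close> is the positive part of the Wright function, since \<open>ennreal\<close> truncates negative
  values. The positive part has integral 1 because \<open>M\<close> is a probability space, and the function itself has integral
  1 by \<open>wright_laplace\<close> at 0; hence the negative part has integral 0.
\<close>

lemma wright_density_nonneg:
  assumes "0 < \<nu>" "\<nu> < 1" "prob_space M" "wright_distributed M \<nu> \<Xi>"
  shows "AE \<xi> in lborel. \<xi> > 0 \<longrightarrow> 0 \<le> wright (- \<nu>) (1 - \<nu>) (- \<xi>)"
proof -
  interpret prob_space M by fact
  define f where "f \<xi> = (if \<xi> > 0 then wright (- \<nu>) (1 - \<nu>) (- \<xi>) else 0)" for \<xi>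
  have dist: "distributed M lborel \<Xi> (\<lambda>\<xi>. ennreal (f \<xi>))"
    using assms by (simp add: wright_distributed_def f_def)
  have f_ind: "f = (\<lambda>\<xi>. indicator {0<..} \<xi> *\<^sub>R (exp (- (0 * \<xi>)) * wright (- \<nu>) (1 - \<nu>) (- \<xi>)))"
    by (auto simp: f_def indicator_def)
  have int: "integrable lborel f"
    using wright_laplace(1)[OF assms(1,2), of 0] by (simp add: f_ind set_integrable_def)
  have "(\<lambda>n. (- 0) ^ n * rGamma (1 + \<nu> * real n)) sums (LBINT \<xi>. f \<xi>)"
    using wright_laplace(2)[OF assms(1,2), of 0] unfolding f_ind set_lebesgue_integral_def by simp
  moreover have "(\<lambda>n. (- 0) ^ n * rGamma (1 + \<nu> * real n)) sums (rGamma (1 + \<nu> * real 0))"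
    using sums_single[of 0 "\<lambda>n. rGamma (1 + \<nu> * real n)"]
    by (rule back_subst[of "\<lambda>f. f sums _"]) (auto simp: fun_eq_iff power_0_left)
  ultimately have one: "(LBINT \<xi>. f \<xi>) = 1"
    using sums_unique2 by fastforce
  have pos: "(\<integral>\<^sup>+\<xi>. ennreal (f \<xi>) \<partial>lborel) = 1"
    using distributed_nn_integral[OF dist, of "\<lambda>_. 1"] by (simp add: emeasure_space_1)
  have "enn2real (\<integral>\<^sup>+\<xi>. ennreal (- f \<xi>) \<partial>lborel) = 0"
    using one pos real_lebesgue_integral_def[OF int] by simp
  moreover have "(\<integral>\<^sup>+\<xi>. ennreal (- f \<xi>) \<partial>lborel) \<noteq> \<infinity>"
    using int by (simp add: real_integrable_def)
  ultimately have "(\<integral>\<^sup>+\<xi>. ennreal (- f \<xi>) \<partial>lborel) = 0"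
    by (auto simp: enn2real_eq_0_iff)
  then have "AE \<xi> in lborel. ennreal (- f \<xi>) = 0"
    using int by (subst (asm) nn_integral_0_iff_AE) auto
  then show ?thesis
    by eventually_elim (auto simp: f_def ennreal_eq_0_iff split: if_splits)
qed

lemma wright_distributed_pos:
  assumes "\<nu> \<le> 1" "wright_distributed M \<nu> \<Xi>"
  shows "AE \<omega> in M. \<Xi> \<omega> > 0"
proof (cases "\<nu> = 1")
  case True
  then have *: "\<Xi> \<in> borel_measurable M" "distr M borel \<Xi> = return borel 1"
    using assms by (auto simp: wright_distributed_def)
  have "AE \<xi> in distr M borel \<Xi>. \<xi> > (0::real)"
    unfolding *(2) by (subst AE_return) auto
  then show ?thesis
    by (rule AE_distrD[OF *(1)])
next
  case False
  then have dist: "distributed M lborel \<Xi> (\<lambda>\<xi>. ennreal (if \<xi> > 0 then wright (- \<nu>) (1 - \<nu>) (- \<xi>) else 0))"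
    using assms by (simp add: wright_distributed_def)
  have "AE \<xi> in distr M lborel \<Xi>. \<xi> > (0::real)"
    unfolding distributed_distr_eq_density[OF dist]
    by (subst AE_density) (use dist in \<open>auto simp: distributed_def\<close>)
  then show ?thesis
    by (rule AE_distrD[OF distributed_measurable[OF dist]])
qed

lemma wright_distributed_laplace:
  assumes "0 < \<nu>" "\<nu> \<le> 1" "prob_space M" "wright_distributed M \<nu> \<Xi>" "s \<ge> 0"
  shows "(\<lambda>n. (- s) ^ n * rGamma (1 + \<nu> * real n)) sums (\<integral>\<omega>. exp (- (s * \<Xi> \<omega>)) \<partial>M)"
proof (cases "\<nu> = 1")
  case True
  interpret prob_space M by fact
  have [measurable]: "\<Xi> \<in> borel_measurable M" and eq: "distr M borel \<Xi> = return borel 1"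
    using assms True by (auto simp: wright_distributed_def)
  have "(\<integral>\<omega>. exp (- (s * \<Xi> \<omega>)) \<partial>M) = (\<integral>\<xi>. exp (- (s * \<xi>)) \<partial>distr M borel \<Xi>)"
    by (subst integral_distr) auto
  also have "\<dots> = exp (- s)"
    unfolding eq by (subst integral_return) auto
  moreover have "(\<lambda>n. (- s) ^ n * rGamma (1 + \<nu> * real n)) = (\<lambda>n. (- s) ^ n /\<^sub>R fact n)"
    using Gamma_fact[where 'a = real] by (auto simp: fun_eq_iff True rGamma_inverse_Gamma field_simps)
  ultimately show ?thesis
    using exp_converges[of "- s"] by simp
next
  case False
  interpret prob_space M by fact
  have \<nu>: "\<nu> < 1" using assms False by simp
  define f where "f \<xi> = (if \<xi> > 0 then wright (- \<nu>) (1 - \<nu>) (- \<xi>) else 0)" for \<xi>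
  have "distributed M lborel \<Xi> (\<lambda>\<xi>. ennreal (f \<xi>))"
    using assms False by (simp add: wright_distributed_def f_def)
  moreover have ennreal_max: "ennreal (max 0 x) = ennreal x" for x
    by (cases "x \<ge> 0") (auto simp: max_def ennreal_neg)
  ultimately have dist: "distributed M lborel \<Xi> (\<lambda>\<xi>. ennreal (max 0 (f \<xi>)))"
    by (simp only: ennreal_max)
  have "(\<integral>\<omega>. exp (- (s * \<Xi> \<omega>)) \<partial>M) = (LBINT \<xi>. max 0 (f \<xi>) * exp (- (s * \<xi>)))"
    by (rule distributed_integral[OF dist, symmetric]) auto
  also have "\<dots> = (LBINT \<xi>:{0<..}. exp (- (s * \<xi>)) * wright (- \<nu>) (1 - \<nu>) (- \<xi>))"
    unfolding set_lebesgue_integral_def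
  proof (rule integral_cong_AE)
    show "(\<lambda>\<xi>. indicat_real {0<..} \<xi> *\<^sub>R (exp (- (s * \<xi>)) * wright (- \<nu>) (1 - \<nu>) (- \<xi>))) \<in> borel_measurable lborel"
      using wright_laplace(1)[OF assms(1) \<nu> assms(5)] unfolding set_integrable_def by (rule borel_measurable_integrable)
    show "(\<lambda>\<xi>. max 0 (f \<xi>) * exp (- (s * \<xi>))) \<in> borel_measurable lborel"
      using distributed_real_measurable[OF _ dist] by auto
    show "AE \<xi> in lborel. max 0 (f \<xi>) * exp (- (s * \<xi>)) =
        indicat_real {0<..} \<xi> *\<^sub>R (exp (- (s * \<xi>)) * wright (- \<nu>) (1 - \<nu>) (- \<xi>))"
      using wright_density_nonneg[OF assms(1) \<nu> assms(3,4)]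
      by eventually_elim (auto simp: f_def max_def)
  qed
  finally show ?thesis
    using wright_laplace(2)[OF assms(1) \<nu> assms(5)] by simp
qed


section \<open>Caputo equations as Volterra equations\<close>

lemma set_integral_finite_sum:
  fixes f :: "'i \<Rightarrow> 'a \<Rightarrow> real"
  assumes "\<And>i. i \<in> I \<Longrightarrow> set_integrable M A (f i)"
  shows "set_integrable M A (\<lambda>x. \<Sum>i\<in>I. f i x)"
    and "(LINT x:A|M. (\<Sum>i\<in>I. f i x)) = (\<Sum>i\<in>I. LINT x:A|M. f i x)"
  using assms unfolding set_integrable_def set_lebesgue_integral_def
  by (simp_all add: sum_distrib_left Bochner_Integration.integral_sum)

text \<open>
  Euler's Beta integral transported from the unit interval to \<open>(s, t)\<close>.
\<close>

lemma beta_integral_interval: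
  fixes a b s t :: real
  assumes "a > 0" "b > 0" "s < t"
  shows "set_integrable lborel {s<..<t} (\<lambda>u. (t - u) powr (a - 1) * (u - s) powr (b - 1))"
    and "(LBINT u:{s<..<t}. (t - u) powr (a - 1) * (u - s) powr (b - 1)) = Beta a b * (t - s) powr (a + b - 1)"
proof -
  let ?f = "\<lambda>u. indicator {s<..<t} u *\<^sub>R ((t - u) powr (a - 1) * (u - s) powr (b - 1))"
  let ?g = "\<lambda>x. x powr (b - 1) * (1 - x) powr (a - 1)"
  have "set_integrable lborel {0<..<1} ?g"
    by (rule set_integrable_subset[OF integrable_Beta[OF assms(2,1)]]) auto
  moreover have "(LBINT x:{0<..<1}. ?g x) = Beta a b"
  proof -
    have "(?g has_integral Beta b a) {0<..<1}"
      using has_integral_Beta_real[OF assms(2,1)] has_integral_Icc_iff_Ioo[of ?g] by blast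
    then show ?thesis
      using set_borel_integral_eq_integral(2)[OF \<open>set_integrable lborel {0<..<1} ?g\<close>]
      by (simp add: integral_unique Beta_commute)
  qed
  ultimately have "has_bochner_integral lborel (\<lambda>x. indicator {0<..<1} x *\<^sub>R ?g x) (Beta a b)"
    unfolding set_integrable_def set_lebesgue_integral_def by (simp add: has_bochner_integral_iff)
  then have "has_bochner_integral lborel
      (\<lambda>x. (t - s) powr (a + b - 2) * (indicator {0<..<1} x *\<^sub>R ?g x)) ((t - s) powr (a + b - 2) * Beta a b)"
    by (rule has_bochner_integral_mult_right) 
  moreover have "?f (s + (t - s) * x) = (t - s) powr (a + b - 2) * (indicator {0<..<1} x *\<^sub>R ?g x)" for x
  proof (cases "0 < x \<and> x < 1")
    case True
    then have "s + (t - s) * x \<in> {s<..<t}"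
    proof -
      have "0 < (t - s) * x" "(t - s) * x < (t - s) * 1"
        using True assms(3) by (auto intro!: mult_pos_pos mult_strict_left_mono)
      then show ?thesis by simp
    qed
    moreover have "t - (s + (t - s) * x) = (t - s) * (1 - x)" "s + (t - s) * x - s = (t - s) * x"
      by (auto simp: algebra_simps)
    ultimately show ?thesis
      using True assms(3) by (simp add: powr_mult powr_add[symmetric] mult_ac)
  next
    case False
    have "s + (t - s) * x \<notin> {s<..<t}"
    proof
      assume "s + (t - s) * x \<in> {s<..<t}"
      then have "0 < (t - s) * x" "(t - s) * x < t - s"
        unfolding greaterThanLessThan_iff by linarith+
      then have *: "0 < (t - s) * x" "(t - s) * x < (t - s) * 1" by (simp_all only: mult_1_right)
      have "0 < x" "x < 1"
        using zero_less_mult_pos[OF *(1)] mult_left_less_imp_less[OF *(2)] assms(3) by auto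
      with False show False by simp
    qed
    with False show ?thesis by auto
  qed
  moreover have "(t - s) powr (a + b - 2) * Beta a b = (Beta a b * (t - s) powr (a + b - 1)) /\<^sub>R \<bar>t - s\<bar>"
  proof -
    have "(t - s) powr (a + b - 1) = (t - s) powr (a + b - 2) * (t - s)"
      using assms(3) powr_add[of "t - s" "a + b - 2" 1] by simp
    then show ?thesis using assms(3) by simp
  qed
  ultimately have "has_bochner_integral lborel ?f (Beta a b * (t - s) powr (a + b - 1))"
    using lborel_has_bochner_integral_real_affine_iff[of "t - s" ?f _ s] assms(3) by simp
  then show "set_integrable lborel {s<..<t} (\<lambda>u. (t - u) powr (a - 1) * (u - s) powr (b - 1))"
    "(LBINT u:{s<..<t}. (t - u) powr (a - 1) * (u - s) powr (b - 1)) = Beta a b * (t - s) powr (a + b - 1)"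
    unfolding set_integrable_def set_lebesgue_integral_def by (simp_all add: has_bochner_integral_iff)
qed

text \<open>
  The Riemann-Liouville integral of order \<open>\<nu>\<close>.
\<close>

definition fractional_integral :: "real \<Rightarrow> (real \<Rightarrow> real) \<Rightarrow> real \<Rightarrow> real" where
  "fractional_integral \<nu> f t = (LBINT s:{0<..<t}. (t - s) powr (\<nu> - 1) * f s) / Gamma \<nu>"

lemma fractional_integrand_integrable:
  fixes \<nu> t C :: real and f :: "real \<Rightarrow> real"
  assumes "\<nu> > 0" "t > 0" "continuous_on {0<..<t} f" "\<And>s. s \<in> {0<..<t} \<Longrightarrow> \<bar>f s\<bar> \<le> C"
  shows "set_integrable lborel {0<..<t} (\<lambda>s. (t - s) powr (\<nu> - 1) * f s)"
proof (rule set_integrable_bound)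
  have "set_integrable lborel {0<..<t} (\<lambda>s. (t - s) powr (\<nu> - 1) * (s - 0) powr (1 - 1))"
    using beta_integral_interval(1)[of \<nu> 1 0 t] assms by simp
  then show "set_integrable lborel {0<..<t} (\<lambda>s. C * ((t - s) powr (\<nu> - 1) * (s - 0) powr (1 - 1)))"
    by (rule set_integrable_mult_right)
  show "set_borel_measurable lborel {0<..<t} (\<lambda>s. (t - s) powr (\<nu> - 1) * f s)"
    unfolding set_borel_measurable_def
    by (subst measurable_lborel2, rule borel_measurable_continuous_on_indicator)
       (use assms in \<open>auto intro!: continuous_intros\<close>)
  show "AE s in lborel. s \<in> {0<..<t} \<longrightarrow> norm ((t - s) powr (\<nu> - 1) * f s)
      \<le> norm (C * ((t - s) powr (\<nu> - 1) * (s - 0) powr (1 - 1)))"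
  proof (intro AE_I2 impI)
    fix s assume s: "s \<in> {0<..<t}"
    then have "\<bar>f s\<bar> \<le> \<bar>C\<bar>" using assms(4)[OF s] by linarith
    then show "norm ((t - s) powr (\<nu> - 1) * f s) \<le> norm (C * ((t - s) powr (\<nu> - 1) * (s - 0) powr (1 - 1)))"
      using s by (simp add: abs_mult mult.commute mult_right_mono)
  qed
qed

lemma continuous_fractional_integrand_integrable:
  fixes \<nu> t :: real and f :: "real \<Rightarrow> real"
  assumes "\<nu> > 0" "t > 0" "continuous_on {0..} f"
  shows "set_integrable lborel {0<..<t} (\<lambda>s. (t - s) powr (\<nu> - 1) * f s)"
proof -
  have "bounded (f ` {0..t})"
    by (intro compact_imp_bounded compact_continuous_image continuous_on_subset[OF assms(3)] compact_Icc) auto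
  then obtain C where "\<forall>s\<in>{0..t}. \<bar>f s\<bar> \<le> C"
    by (auto simp: bounded_iff)
  then have C: "\<And>s. s \<in> {0..t} \<Longrightarrow> \<bar>f s\<bar> \<le> C"
    by blast
  with assms show ?thesis
    by (intro fractional_integrand_integrable[of _ _ _ C]) (auto intro: continuous_on_subset)
qed

text \<open>
  The values of \<open>1 / \<Gamma>\<close> on both sides are placed such that the Mittag-Leffler monomials
  \<open>t^\<beta> / \<Gamma>(1 + \<beta>)\<close> are mapped to each other.
\<close>

lemma fractional_integral_powr:
  assumes "\<nu> > 0" "\<beta> \<ge> 0" "t > 0"
  shows "set_integrable lborel {0<..<t} (\<lambda>s. (t - s) powr (\<nu> - 1) * s powr \<beta>)"
    and "fractional_integral \<nu> (\<lambda>s. s powr \<beta>) t * rGamma (1 + \<beta>) = t powr (\<beta> + \<nu>) * rGamma (1 + (\<beta> + \<nu>))"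
proof -
  note * = beta_integral_interval[of \<nu> "\<beta> + 1" 0 t]
  show "set_integrable lborel {0<..<t} (\<lambda>s. (t - s) powr (\<nu> - 1) * s powr \<beta>)"
    using *(1) assms by simp
  have "(LBINT s:{0<..<t}. (t - s) powr (\<nu> - 1) * s powr \<beta>) = Beta \<nu> (\<beta> + 1) * t powr (\<beta> + \<nu>)"
    using *(2) assms by (simp add: add.commute)
  moreover have "Gamma \<nu> > 0" "Gamma (1 + \<beta>) > 0"
    using assms by (auto intro!: Gamma_real_pos)
  ultimately show "fractional_integral \<nu> (\<lambda>s. s powr \<beta>) t * rGamma (1 + \<beta>) = t powr (\<beta> + \<nu>) * rGamma (1 + (\<beta> + \<nu>))"
    by (simp add: fractional_integral_def Beta_def rGamma_inverse_Gamma field_simps add_ac)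
qed

lemma ftc_lebesgue_open_interval:
  fixes f :: "real \<Rightarrow> real"
  assumes "t > 0" "continuous_on {0..t} f" "\<And>s. s \<in> {0<..<t} \<Longrightarrow> (f has_real_derivative g s) (at s)"
    and "set_integrable lborel {0<..<t} g"
  shows "(LBINT s:{0<..<t}. g s) = f t - f 0"
proof -
  have "(g has_integral f t - f 0) {0..t}"
    using assms by (intro fundamental_theorem_of_calculus_interior)
      (auto simp: has_real_derivative_iff_has_vector_derivative)
  then have "(g has_integral f t - f 0) {0<..<t}"
    by (simp add: has_integral_Icc_iff_Ioo)
  then show ?thesis
    using set_borel_integral_eq_integral(2)[OF assms(4)] by (simp add: integral_unique)
qed

text \<open>
  The Riemann-Liouville integral inverts the Caputo derivative. By Fubini's theorem the composition of
  the two kernels \<open>(t - u)^(\<nu> - 1)\<close> and \<open>(u - s)^(- \<nu>)\<close> is the constant \<open>\<Gamma>(\<nu>) \<Gamma>(1 - \<nu>)\<close>, so that only the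
  integral of \<open>f'\<close> remains. The derivative is integrable on \<open>(0, t)\<close> since the singular kernel is bounded below
  there.
\<close>

lemma caputo_imp_volterra:
  assumes \<nu>: "0 < \<nu>" "\<nu> \<le> 1" and "t > 0"
    and f: "continuous_on {0..} f" and h: "continuous_on {0..} h"
    and D: "\<And>t. t > 0 \<Longrightarrow> caputo_differentiable \<nu> f t" "\<And>t. t > 0 \<Longrightarrow> caputo_deriv \<nu> f t = h t"
  shows "f t = f 0 + fractional_integral \<nu> h t"
proof (cases "\<nu> = 1")
  case True
  have "(LBINT s:{0<..<t}. h s) = f t - f 0"
  proof (rule ftc_lebesgue_open_interval)
    show "(f has_real_derivative h s) (at s)" if "s \<in> {0<..<t}" for s
      using that D[of s] True
      by (simp add: caputo_differentiable_def caputo_deriv_def DERIV_deriv_iff_real_differentiable[symmetric])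
    show "continuous_on {0..t} f" by (rule continuous_on_subset[OF f]) auto
    have "set_integrable lborel {0..t} h"
      by (intro borel_integrable_atLeastAtMost' continuous_on_subset[OF h]) auto
    then show "set_integrable lborel {0<..<t} h"
      by (rule set_integrable_subset) auto
  qed fact
  moreover have "(LBINT s:{0<..<t}. (t - s) powr (1 - 1) * h s) = (LBINT s:{0<..<t}. h s)"
    by (intro set_lebesgue_integral_cong) auto
  ultimately show ?thesis
    by (simp add: fractional_integral_def True)
next
  case False
  with \<nu> have \<nu>1: "\<nu> < 1" by simp
  have diff: "(f has_real_derivative deriv f s) (at s)" if "s > 0" for s
    using D(1)[of "s + 1"] that False
    by (simp add: caputo_differentiable_def DERIV_deriv_iff_real_differentiable)
  have kern: "set_integrable lborel {0<..<u} (\<lambda>s. deriv f s / (u - s) powr \<nu>)" if "u > 0" for u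
    using D(1)[OF that] False by (simp add: caputo_differentiable_def)
  \<comment> \<open>The Borel measurability of \<open>f'\<close> on \<open>(0, t)\<close> comes from the integrability of the Caputo integrand.\<close>
  define d where "d s = indicator {0<..<t} s *\<^sub>R deriv f s" for s
  have d_eq: "d = (\<lambda>s. (indicator {0<..<t} s *\<^sub>R (deriv f s / (t - s) powr \<nu>)) * (t - s) powr \<nu>)"
    by (auto simp: d_def indicator_def)
  have [measurable]: "d \<in> borel_measurable borel"
    using borel_measurable_integrable[OF kern[OF \<open>t > 0\<close>, unfolded set_integrable_def]]
    unfolding d_eq by (intro borel_measurable_times) auto
  have int_d: "integrable lborel d"
  proof (rule Bochner_Integration.integrable_bound)
    show "integrable lborel (\<lambda>s. t powr \<nu> * (indicator {0<..<t} s *\<^sub>R (deriv f s / (t - s) powr \<nu>)))"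
      using kern[OF \<open>t > 0\<close>] unfolding set_integrable_def by (rule integrable_mult_right)
    show "AE s in lborel. norm (d s) \<le> norm (t powr \<nu> * (indicator {0<..<t} s *\<^sub>R (deriv f s / (t - s) powr \<nu>)))"
    proof (rule AE_I2)
      fix s
      show "norm (d s) \<le> norm (t powr \<nu> * (indicator {0<..<t} s *\<^sub>R (deriv f s / (t - s) powr \<nu>)))"
      proof (cases "0 < s \<and> s < t")
        case True
        then have "(t - s) powr \<nu> \<le> t powr \<nu>" "(t - s) powr \<nu> > 0"
          using \<nu> by (auto intro!: powr_mono2)
        moreover from this(1) have "\<bar>deriv f s\<bar> * (t - s) powr \<nu> \<le> \<bar>deriv f s\<bar> * t powr \<nu>"
          by (rule mult_left_mono) simp
        ultimately show ?thesis
          using True by (simp add: d_def abs_mult pos_le_divide_eq mult.commute)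
      qed (auto simp: d_def)
    qed
  qed simp
  have ftc: "integral\<^sup>L lborel d = f t - f 0"
    using ftc_lebesgue_open_interval[of t f "deriv f"] diff \<open>t > 0\<close> int_d continuous_on_subset[OF f, of "{0..t}"]
    unfolding d_def[abs_def] set_lebesgue_integral_def set_integrable_def by simp
  \<comment> \<open>The composed kernel; its exponents are those of a Beta integral with parameters \<open>\<nu>\<close> and \<open>1 - \<nu>\<close>.\<close>
  define b where "b s u = indicator {s<..<t} u *\<^sub>R ((t - u) powr (\<nu> - 1) * (u - s) powr ((1 - \<nu>) - 1))" for s u
  have [measurable]: "(\<lambda>(s, u). b s u) \<in> borel_measurable (lborel \<Otimes>\<^sub>M lborel)"
  proof -
    have "(\<lambda>(s, u). b s u) = (\<lambda>(s, u). (if s < u \<and> u < t then 1 else 0) * ((t - u) powr (\<nu> - 1) * (u - s) powr ((1 - \<nu>) - 1)))"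
      by (auto simp: b_def fun_eq_iff)
    then show ?thesis by simp
  qed
  have b: "integrable lborel (b s)" "integral\<^sup>L lborel (b s) = Gamma \<nu> * Gamma (1 - \<nu>)" if "s < t" for s
    using beta_integral_interval[of \<nu> "1 - \<nu>" s t] that \<nu> \<nu>1
    by (auto simp: b_def[abs_def] set_integrable_def set_lebesgue_integral_def Beta_def Gamma_1)
  have b0: "b s u \<ge> 0" for s u by (simp add: b_def)
  have Gam: "Gamma \<nu> > 0" "Gamma (1 - \<nu>) > 0" using \<nu> \<nu>1 by auto
  have s_int: "(LBINT u. d s * b s u) = d s * (Gamma \<nu> * Gamma (1 - \<nu>))" for s
    by (cases "s < t") (auto simp: b(2) d_def)
  have prod_int: "integrable (lborel \<Otimes>\<^sub>M lborel) (\<lambda>(s, u). d s * b s u)"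
  proof (rule lborel_pair.Fubini_integrable)
    show "(\<lambda>(s, u). d s * b s u) \<in> borel_measurable (lborel \<Otimes>\<^sub>M lborel)"
      by measurable
    have "(LBINT u. norm (d s * b s u)) = \<bar>d s\<bar> * (Gamma \<nu> * Gamma (1 - \<nu>))" for s
      using b0 by (cases "s < t") (auto simp: abs_mult b(2) d_def)
    then show "integrable lborel (\<lambda>s. LBINT u. norm (case (s, u) of (s, u) \<Rightarrow> d s * b s u))"
      using int_d by simp
    have "integrable lborel (\<lambda>u. d s * b s u)" for s
      by (cases "s < t") (auto simp: b(1) d_def)
    then show "AE s in lborel. integrable lborel (\<lambda>u. case (s, u) of (s, u) \<Rightarrow> d s * b s u)"
      by simp
  qed
  have u_int: "(LBINT s. d s * b s u) = indicator {0<..<t} u *\<^sub>R ((t - u) powr (\<nu> - 1) * h u) * Gamma (1 - \<nu>)" for u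
  proof (cases "0 < u \<and> u < t")
    case True
    have "d s * b s u = (t - u) powr (\<nu> - 1) * (indicator {0<..<u} s *\<^sub>R (deriv f s / (u - s) powr \<nu>))" for s
      using True by (auto simp: d_def b_def indicator_def powr_minus divide_inverse)
    then have "(LBINT s. d s * b s u) = (t - u) powr (\<nu> - 1) * (LBINT s:{0<..<u}. deriv f s / (u - s) powr \<nu>)"
      unfolding set_lebesgue_integral_def by (simp only: integral_mult_right_zero)
    also have "(LBINT s:{0<..<u}. deriv f s / (u - s) powr \<nu>) = h u * Gamma (1 - \<nu>)"
      using D(2)[of u] True False Gam by (simp add: caputo_deriv_def field_simps)
    finally show ?thesis using True by simp
  next
    case no: False
    then have "d s * b s u = 0" for s by (auto simp: d_def b_def indicator_def)
    then have "(LBINT s. d s * b s u) = (LBINT s :: real. 0 :: real)" by (simp only:)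
    then show ?thesis using no by auto
  qed
  have "(f t - f 0) * (Gamma \<nu> * Gamma (1 - \<nu>)) = (LBINT s. LBINT u. d s * b s u)"
    unfolding s_int by (simp add: ftc)
  also have "\<dots> = (LBINT u. LBINT s. d s * b s u)"
    using lborel_pair.Fubini_integral[OF prod_int] by simp
  also have "\<dots> = (LBINT u:{0<..<t}. (t - u) powr (\<nu> - 1) * h u) * Gamma (1 - \<nu>)"
    unfolding u_int by (simp add: set_lebesgue_integral_def)
  finally have "(f t - f 0) * Gamma \<nu> * Gamma (1 - \<nu>) =
      (LBINT u:{0<..<t}. (t - u) powr (\<nu> - 1) * h u) * Gamma (1 - \<nu>)"
    by (simp only: mult.assoc)
  then have "(f t - f 0) * Gamma \<nu> = (LBINT u:{0<..<t}. (t - u) powr (\<nu> - 1) * h u)"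
    using Gam by (simp only: mult_right_cancel)
  then have "f t - f 0 = fractional_integral \<nu> h t"
    unfolding fractional_integral_def by (rule eq_divide_imp[rotated]) (use Gam in simp)
  then show ?thesis by linarith
qed

text \<open>
  Picard iteration. Substituting the equation into itself \<open>N\<close> times gives the partial sum \<open>E N\<close> of the
  Mittag-Leffler series plus \<open>(- a)^N\<close> times the \<open>N\<close>-fold fractional integral of \<open>c\<close>. As \<open>c\<close> is bounded on
  \<open>[0, t]\<close>, this remainder is controlled by the \<open>N\<close>-th term of the series, which tends to 0.
\<close>

lemma volterra_solution:
  assumes \<nu>: "0 < \<nu>" and "a > 0" and c: "continuous_on {0..} c"
    and eq: "\<And>t. t > 0 \<Longrightarrow> c t = 1 - a * fractional_integral \<nu> c t"
    and "t > 0" and summ: "summable (\<lambda>n. (- (a * t powr \<nu>)) ^ n * rGamma (1 + \<nu> * real n))"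
  shows "(\<lambda>n. (- (a * t powr \<nu>)) ^ n * rGamma (1 + \<nu> * real n)) sums c t"
proof -
  define E where "E N t = (\<Sum>n<N. (- a) ^ n * rGamma (1 + \<nu> * real n) * t powr (\<nu> * real n))" for N t
  have "bounded (c ` {0..t})"
    by (intro compact_imp_bounded compact_continuous_image continuous_on_subset[OF c] compact_Icc) auto
  then obtain C where "\<forall>s\<in>{0..t}. \<bar>c s\<bar> \<le> C"
    by (auto simp: bounded_iff)
  then have C: "\<And>s. s \<in> {0..t} \<Longrightarrow> \<bar>c s\<bar> \<le> C"
    by blast
  have rG: "rGamma (1 + \<nu> * real n) > 0" for n
    using \<nu> by (simp add: rGamma_inverse_Gamma Gamma_real_pos add_pos_nonneg)
  have rem: "\<bar>c r - E N r\<bar> \<le> C * a ^ N * rGamma (1 + \<nu> * real N) * r powr (\<nu> * real N)" if "0 < r" "r \<le> t" for N r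
    using that
  proof (induction N arbitrary: r)
    case 0
    then show ?case using C[of r] by (simp add: E_def)
  next
    case (Suc N r)
    let ?k = "\<lambda>s. (r - s) powr (\<nu> - 1)"
    have int_c: "set_integrable lborel {0<..<r} (\<lambda>s. ?k s * c s)"
      using Suc.prems \<nu> c by (intro continuous_fractional_integrand_integrable) auto
    have int_p: "set_integrable lborel {0<..<r} (\<lambda>s. ?k s * s powr (\<nu> * real n))" for n
      using Suc.prems \<nu> by (intro fractional_integral_powr) auto
    have int_t: "set_integrable lborel {0<..<r} (\<lambda>s. (- a) ^ n * rGamma (1 + \<nu> * real n) * (?k s * s powr (\<nu> * real n)))" for n
      by (rule set_integrable_mult_right) (rule int_p)
    have int_E: "set_integrable lborel {0<..<r} (\<lambda>s. ?k s * E N s)"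
    proof -
      have "set_integrable lborel {0<..<r} (\<lambda>s. \<Sum>n<N. (- a) ^ n * rGamma (1 + \<nu> * real n) * (?k s * s powr (\<nu> * real n)))"
        by (rule set_integral_finite_sum(1)) (rule int_t)
      then show ?thesis by (simp add: E_def sum_distrib_left mult_ac)
    qed
    have step: "fractional_integral \<nu> (\<lambda>s. s powr (\<nu> * real n)) r * rGamma (1 + \<nu> * real n)
        = r powr (\<nu> * real (Suc n)) * rGamma (1 + \<nu> * real (Suc n))" for n
      using fractional_integral_powr(2)[of \<nu> "\<nu> * real n" r] Suc.prems \<nu> by (simp add: algebra_simps)
    have E_int: "fractional_integral \<nu> (E N) r =
        (\<Sum>n<N. (- a) ^ n * (fractional_integral \<nu> (\<lambda>s. s powr (\<nu> * real n)) r * rGamma (1 + \<nu> * real n)))"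
    proof -
      have "(LBINT s:{0<..<r}. ?k s * E N s) =
          (LBINT s:{0<..<r}. \<Sum>n<N. (- a) ^ n * rGamma (1 + \<nu> * real n) * (?k s * s powr (\<nu> * real n)))"
        by (simp add: E_def sum_distrib_left mult_ac)
      also have "\<dots> = (\<Sum>n<N. (- a) ^ n * rGamma (1 + \<nu> * real n) * (LBINT s:{0<..<r}. ?k s * s powr (\<nu> * real n)))"
        by (simp only: set_integral_finite_sum(2)[OF int_t] set_integral_mult_right)
      finally show ?thesis
        by (simp add: fractional_integral_def sum_divide_distrib mult_ac)
    qed
    have E_step: "E (Suc N) r = 1 - a * fractional_integral \<nu> (E N) r"
    proof -
      have "E (Suc N) r = 1 + (\<Sum>n<N. (- a) ^ Suc n * rGamma (1 + \<nu> * real (Suc n)) * r powr (\<nu> * real (Suc n)))"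
        using Suc.prems unfolding E_def by (subst sum.lessThan_Suc_shift) simp
      also have "\<dots> = 1 - a * (\<Sum>n<N. (- a) ^ n * (r powr (\<nu> * real (Suc n)) * rGamma (1 + \<nu> * real (Suc n))))"
        by (simp add: sum_distrib_left sum_negf[symmetric] mult_ac del: of_nat_Suc)
      finally show ?thesis unfolding E_int step .
    qed
    have c_r: "c r = 1 - a * fractional_integral \<nu> c r"
      using eq Suc.prems by blast
    have "c r - E (Suc N) r = - a * (fractional_integral \<nu> c r - fractional_integral \<nu> (E N) r)"
      using c_r E_step by algebra
    also have "fractional_integral \<nu> c r - fractional_integral \<nu> (E N) r =
        (LBINT s:{0<..<r}. ?k s * (c s - E N s)) / Gamma \<nu>"
      unfolding fractional_integral_def diff_divide_distrib[symmetric] right_diff_distrib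
      using set_integral_diff(2)[OF int_c int_E] by simp
    finally have "\<bar>c r - E (Suc N) r\<bar> = a / Gamma \<nu> * \<bar>LBINT s:{0<..<r}. ?k s * (c s - E N s)\<bar>"
      using \<open>a > 0\<close> Gamma_real_pos[OF \<nu>] by (simp add: abs_mult)
    also have "\<dots> \<le> a / Gamma \<nu> * (LBINT s:{0<..<r}. C * a ^ N * rGamma (1 + \<nu> * real N) * (?k s * s powr (\<nu> * real N)))"
    proof (intro mult_left_mono)
      have int_d: "set_integrable lborel {0<..<r} (\<lambda>s. ?k s * (c s - E N s))"
        using set_integral_diff(1)[OF int_c int_E] by (simp add: right_diff_distrib)
      have "\<bar>LBINT s:{0<..<r}. ?k s * (c s - E N s)\<bar> \<le> (LBINT s:{0<..<r}. norm (?k s * (c s - E N s)))"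
        using set_integral_norm_bound[OF int_d] by simp
      also have "\<dots> \<le> (LBINT s:{0<..<r}. C * a ^ N * rGamma (1 + \<nu> * real N) * (?k s * s powr (\<nu> * real N)))"
      proof (rule set_integral_mono)
        show "set_integrable lborel {0<..<r} (\<lambda>s. norm (?k s * (c s - E N s)))"
          by (rule set_integrable_norm[OF int_d])
        show "set_integrable lborel {0<..<r} (\<lambda>s. C * a ^ N * rGamma (1 + \<nu> * real N) * (?k s * s powr (\<nu> * real N)))"
          by (intro set_integrable_mult_right int_p)
        show "norm (?k s * (c s - E N s)) \<le> C * a ^ N * rGamma (1 + \<nu> * real N) * (?k s * s powr (\<nu> * real N))"
          if "s \<in> {0<..<r}" for s
        proof -
          have "?k s * \<bar>c s - E N s\<bar> \<le> ?k s * (C * a ^ N * rGamma (1 + \<nu> * real N) * s powr (\<nu> * real N))"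
            using Suc.IH[of s] Suc.prems that by (intro mult_left_mono) auto
          then show ?thesis by (simp add: abs_mult mult_ac)
        qed
      qed
      finally show "\<bar>LBINT s:{0<..<r}. ?k s * (c s - E N s)\<bar> \<le> \<dots>" .
    qed (use \<open>a > 0\<close> Gamma_real_pos[OF \<nu>] in auto)
    also have "\<dots> = a * (C * a ^ N * (fractional_integral \<nu> (\<lambda>s. s powr (\<nu> * real N)) r * rGamma (1 + \<nu> * real N)))"
      by (simp add: fractional_integral_def)
    also have "\<dots> = C * a ^ Suc N * rGamma (1 + \<nu> * real (Suc N)) * r powr (\<nu> * real (Suc N))"
      unfolding step by (simp add: mult_ac)
    finally show ?case .
  qed
  have term_eq: "(- a) ^ n * rGamma (1 + \<nu> * real n) * t powr (\<nu> * real n) = (- (a * t powr \<nu>)) ^ n * rGamma (1 + \<nu> * real n)" for n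
  proof -
    have "t powr (\<nu> * real n) = (t powr \<nu>) ^ n"
      using \<open>t > 0\<close> by (simp add: powr_powr[symmetric] powr_realpow)
    moreover have "(- (a * t powr \<nu>)) ^ n = (- a) ^ n * (t powr \<nu>) ^ n"
      by (simp add: power_mult_distrib[symmetric])
    ultimately show ?thesis by simp
  qed
  have "(\<lambda>N. C * \<bar>(- (a * t powr \<nu>)) ^ N * rGamma (1 + \<nu> * real N)\<bar>) \<longlonglongrightarrow> 0"
    using tendsto_mult_left[OF tendsto_rabs_zero[OF summable_LIMSEQ_zero[OF summ]], of C]
    by (simp only: mult_zero_right)
  moreover have "norm (E N t - c t) \<le> C * \<bar>(- (a * t powr \<nu>)) ^ N * rGamma (1 + \<nu> * real N)\<bar>" for N
  proof -
    have "\<bar>(- (a * t powr \<nu>)) ^ N * rGamma (1 + \<nu> * real N)\<bar> = a ^ N * rGamma (1 + \<nu> * real N) * t powr (\<nu> * real N)"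
      using \<open>a > 0\<close> rG[of N] unfolding term_eq[symmetric] by (simp add: abs_mult power_abs)
    with rem[of t N] \<open>t > 0\<close> have "\<bar>c t - E N t\<bar> \<le> C * \<bar>(- (a * t powr \<nu>)) ^ N * rGamma (1 + \<nu> * real N)\<bar>"
      by (simp only: mult.assoc order_refl)
    then show ?thesis
      unfolding real_norm_def by (subst abs_minus_commute)
  qed
  ultimately have "(\<lambda>N. E N t - c t) \<longlonglongrightarrow> 0"
    by (metis (no_types, lifting) Lim_null_comparison always_eventually)
  then have "(\<lambda>N. E N t) \<longlonglongrightarrow> c t" by (simp only: LIM_zero_iff)
  then show ?thesis unfolding sums_def E_def term_eq .
qed


section \<open>Binomial transforms and the Yule process\<close>

text \<open>
  The binomial transform diagonalises the generator of the Yule process: it maps the right-hand side of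
  the forward equations (at unit rate) to a multiple of the transform itself.
\<close>

lemma binomial_transform_recurrence:
  fixes x :: "nat \<Rightarrow> real"
  shows "(\<Sum>j\<le>m. real (m choose j) * (- 1) ^ j * (real j * x j - real (Suc j) * x (Suc j))) =
     - (real (Suc m) * (\<Sum>j\<le>m. real (m choose j) * (- 1) ^ j * x (Suc j)))"
proof -
  have "(\<Sum>j\<le>m. real (m choose j) * (- 1) ^ j * (real j * x j)) =
      (\<Sum>j\<le>Suc m. real (m choose j) * (- 1) ^ j * (real j * x j))"
    by simp
  also have "\<dots> = (\<Sum>j\<le>m. real (m choose Suc j) * (- 1) ^ Suc j * (real (Suc j) * x (Suc j)))"
    by (subst sum.atMost_Suc_shift) simp
  finally have "(\<Sum>j\<le>m. real (m choose j) * (- 1) ^ j * (real j * x j - real (Suc j) * x (Suc j))) =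
      (\<Sum>j\<le>m. real (m choose Suc j) * (- 1) ^ Suc j * (real (Suc j) * x (Suc j))) -
      (\<Sum>j\<le>m. real (m choose j) * (- 1) ^ j * (real (Suc j) * x (Suc j)))"
    by (simp only: right_diff_distrib sum_subtractf)
  also have "\<dots> = (\<Sum>j\<le>m. - ((- 1) ^ j * x (Suc j) * real (Suc j * (Suc m choose Suc j))))"
    unfolding sum_subtractf[symmetric]
    by (intro sum.cong refl) (simp add: algebra_simps)
  also have "\<dots> = (\<Sum>j\<le>m. - ((- 1) ^ j * x (Suc j) * real (Suc m * (m choose j))))"
    by (simp only: Suc_times_binomial)
  also have "\<dots> = - (\<Sum>j\<le>m. real (Suc m) * (real (m choose j) * (- 1) ^ j * x (Suc j)))"
    unfolding sum_negf by (simp only: of_nat_mult mult_ac)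
  finally show ?thesis
    by (simp only: sum_distrib_left)
qed

text \<open>
  The transform is triangular with diagonal entries \<open>\<plusminus> 1\<close>.
\<close>

lemma binomial_transform_inject:
  fixes x y :: "nat \<Rightarrow> real"
  assumes "\<And>m. (\<Sum>j\<le>m. real (m choose j) * (- 1) ^ j * x j) = (\<Sum>j\<le>m. real (m choose j) * (- 1) ^ j * y j)"
  shows "x n = y n"
proof (induction n rule: less_induct)
  case (less n)
  have "(\<Sum>j<n. real (n choose j) * (- 1) ^ j * x j) = (\<Sum>j<n. real (n choose j) * (- 1) ^ j * y j)"
    using less by simp
  then have "(- 1) ^ n * x n = (- 1) ^ n * y n"
    using assms[of n] by (simp add: lessThan_Suc_atMost[symmetric])
  then show ?case by simp
qed

lemma binomial_transform_geometric:
  fixes e :: real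
  shows "(\<Sum>j\<le>m. real (m choose j) * (- 1) ^ j * (e * (1 - e) ^ j)) = e ^ Suc m"
proof -
  have "(\<Sum>j\<le>m. real (m choose j) * (- 1) ^ j * (e * (1 - e) ^ j)) =
      e * (\<Sum>j\<le>m. real (m choose j) * (- (1 - e)) ^ j * 1 ^ (m - j))"
  proof -
    have "(- 1) ^ j * (1 - e) ^ j = (- (1 - e)) ^ j" for j
      by (simp only: power_mult_distrib[symmetric] mult_minus1)
    then show ?thesis
      unfolding sum_distrib_left by (intro sum.cong refl) (simp add: mult_ac)
  qed
  also have "\<dots> = e ^ Suc m"
    unfolding binomial_ring[symmetric] by simp
  finally show ?thesis .
qed

lemma linear_ode_zero:
  fixes d :: "real \<Rightarrow> real"
  assumes "continuous_on {0..} d" "d 0 = 0" "\<And>t. t > 0 \<Longrightarrow> (d has_real_derivative c * d t) (at t)" "t \<ge> 0"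
  shows "d t = 0"
proof (cases "t = 0")
  case False
  then have "t > 0" using assms(4) by simp
  have "exp (- (c * t)) * d t = exp (- (c * 0)) * d 0"
  proof (rule DERIV_isconst_end[OF \<open>t > 0\<close>])
    show "continuous_on {0..t} (\<lambda>s. exp (- (c * s)) * d s)"
      by (intro continuous_intros continuous_on_subset[OF assms(1)]) auto
    show "((\<lambda>s. exp (- (c * s)) * d s) has_real_derivative 0) (at s)" if "0 < s" "s < t" for s
      using that by (auto intro!: derivative_eq_intros assms(3) simp: algebra_simps)
  qed
  then show ?thesis by (simp add: assms(2))
qed (simp add: assms)

lemma pure_birth_probs_unique:
  assumes p: "pure_birth_probs b p" and q: "pure_birth_probs b q" and "k \<ge> 1" "t \<ge> 0"
  shows "p k t = q k t"
  using \<open>k \<ge> 1\<close> \<open>t \<ge> 0\<close>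
proof (induction k arbitrary: t rule: less_induct)
  case (less k t)
  note P = p[unfolded pure_birth_probs_def, rule_format, OF less.prems(1)]
  note Q = q[unfolded pure_birth_probs_def, rule_format, OF less.prems(1)]
  have "p k t - q k t = 0"
  proof (rule linear_ode_zero[where c = "- b k" and d = "\<lambda>t. p k t - q k t"])
    show "continuous_on {0..} (\<lambda>t. p k t - q k t)"
      using P Q by (intro continuous_intros) auto
    show "p k 0 - q k 0 = 0" using P Q by simp
    show "((\<lambda>t. p k t - q k t) has_real_derivative - b k * (p k s - q k s)) (at s)" if "s > 0" for s
    proof -
      have "k \<noteq> 1 \<Longrightarrow> p (k - 1) s = q (k - 1) s"
        using less that by auto
      then show ?thesis
        using that P Q by (intro DERIV_cong[OF DERIV_diff]) (auto simp: algebra_simps)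
    qed
  qed (use less in auto)
  then show ?case by simp
qed

lemma yule_probs_unique:
  assumes "yule_probs \<mu> p" "k \<ge> 1" "t \<ge> 0"
  shows "p k t = exp (- \<mu> * t) * (1 - exp (- \<mu> * t)) ^ (k - 1)"
  using pure_birth_probs_unique[of "\<lambda>k. \<mu> * real k" p] assms yule_probs_explicit[of \<mu>]
  unfolding yule_probs_def by blast

text \<open>
  The mean of the conditional probability is the probability, and almost surely the conditional
  probability is given by the explicit Yule law. Stating the result with the explicit law makes the integrand
  measurable in the rate, which is not known of the given solutions of the forward equations.
\<close>

lemma random_rate_yule_mixture:
  assumes X: "random_rate_yule_process M lam \<Xi> X" and "lam > 0" and pos: "AE \<omega> in M. \<Xi> \<omega> > 0"
    and "s \<ge> 0" "k \<ge> 1"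
  defines "g \<equiv> \<lambda>\<omega>. exp (- (lam * s * \<Xi> \<omega>)) * (1 - exp (- (lam * s * \<Xi> \<omega>))) ^ (k - 1)"
  shows "integrable M g" and "measure M {\<omega> \<in> space M. X s \<omega> = k} = integral\<^sup>L M g"
proof -
  interpret prob_space M using X by (simp add: random_rate_yule_process_def)
  have [measurable]: "\<Xi> \<in> borel_measurable M" and Xs: "X s \<in> M \<rightarrow>\<^sub>M count_space {1..}"
    using X \<open>s \<ge> 0\<close> by (auto simp: random_rate_yule_process_def)
  obtain q where q: "\<And>\<mu>. \<mu> > 0 \<Longrightarrow> yule_probs \<mu> (q \<mu>)" and
    cond: "AE \<omega> in M. real_cond_exp M (vimage_algebra (space M) \<Xi> borel)
               (indicator {\<omega> \<in> space M. X s \<omega> = k}) \<omega> = q (lam * \<Xi> \<omega>) k s"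
    using X assms(4,5) unfolding random_rate_yule_process_def by blast
  have g_meas: "g \<in> borel_measurable M" unfolding g_def by measurable
  show "integrable M g"
  proof (rule integrable_const_bound[OF _ g_meas])
    show "AE \<omega> in M. norm (g \<omega>) \<le> 1"
      using pos
    proof eventually_elim
      case (elim \<omega>)
      then have "0 \<le> exp (- (lam * s * \<Xi> \<omega>))" "exp (- (lam * s * \<Xi> \<omega>)) \<le> 1"
        using assms(2,4) by auto
      then show ?case
        unfolding g_def by (auto simp: abs_mult power_abs intro!: mult_le_one power_le_one)
    qed
  qed
  let ?F = "vimage_algebra (space M) \<Xi> borel"
  have sub: "subalgebra M ?F"
    unfolding subalgebra_def by (auto simp: sets_vimage_algebra2 intro!: measurable_sets)
  interpret finite_measure_subalgebra M ?F
    by unfold_locales (rule sub)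
  let ?A = "{\<omega> \<in> space M. X s \<omega> = k}"
  have "?A = X s -` {k} \<inter> space M" by auto
  then have A: "?A \<in> sets M"
    using measurable_sets[OF Xs, of "{k}"] \<open>k \<ge> 1\<close> by simp
  have "measure M ?A = (\<integral>\<omega>. indicat_real ?A \<omega> \<partial>M)"
    using A by simp
  also have "\<dots> = (\<integral>\<omega>. real_cond_exp M ?F (indicator ?A) \<omega> \<partial>M)"
    by (rule real_cond_exp_int(2)[symmetric]) (use A in \<open>auto simp: emeasure_eq_measure\<close>)
  also have "\<dots> = integral\<^sup>L M g"
  proof (rule integral_cong_AE)
    show "AE \<omega> in M. real_cond_exp M ?F (indicator ?A) \<omega> = g \<omega>"
      using cond pos
    proof eventually_elim
      case (elim \<omega>)
      then show ?case
        using yule_probs_unique[OF q[of "lam * \<Xi> \<omega>"] assms(5,4)] assms(2) by (simp add: g_def mult_ac)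
    qed
  qed (use g_meas in auto)
  finally show "measure M ?A = integral\<^sup>L M g" .
qed

lemma random_rate_yule_transform:
  assumes X: "random_rate_yule_process M lam \<Xi> X" and "lam > 0" and pos: "AE \<omega> in M. \<Xi> \<omega> > 0"
    and "s \<ge> 0"
  shows "(\<Sum>j\<le>m. real (m choose j) * (- 1) ^ j * measure M {\<omega> \<in> space M. X s \<omega> = Suc j}) =
    (\<integral>\<omega>. exp (- (lam * real (Suc m) * s * \<Xi> \<omega>)) \<partial>M)"
proof -
  let ?e = "\<lambda>\<omega>. exp (- (lam * s * \<Xi> \<omega>))"
  have mix: "integrable M (\<lambda>\<omega>. ?e \<omega> * (1 - ?e \<omega>) ^ j)"
    "measure M {\<omega> \<in> space M. X s \<omega> = Suc j} = (\<integral>\<omega>. ?e \<omega> * (1 - ?e \<omega>) ^ j \<partial>M)" for j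
    using random_rate_yule_mixture[OF assms, of "Suc j"] by simp_all
  have "(\<Sum>j\<le>m. real (m choose j) * (- 1) ^ j * measure M {\<omega> \<in> space M. X s \<omega> = Suc j}) =
      (\<integral>\<omega>. (\<Sum>j\<le>m. real (m choose j) * (- 1) ^ j * (?e \<omega> * (1 - ?e \<omega>) ^ j)) \<partial>M)"
    unfolding mix(2)
    by (subst Bochner_Integration.integral_sum) (auto intro!: integrable_mult_right mix(1))
  also have "\<dots> = (\<integral>\<omega>. exp (- (lam * real (Suc m) * s * \<Xi> \<omega>)) \<partial>M)"
    unfolding binomial_transform_geometric
    by (simp only: exp_of_nat_mult[symmetric]) (simp add: mult_ac del: of_nat_Suc)
  finally show ?thesis .
qed


section \<open>Equality of the laws\<close>

lemma fractional_integral_linear_combination: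
  fixes f :: "nat \<Rightarrow> real \<Rightarrow> real"
  assumes "\<nu> > 0" "t > 0" "\<And>i. i \<in> I \<Longrightarrow> continuous_on {0..} (f i)"
  shows "fractional_integral \<nu> (\<lambda>s. \<Sum>i\<in>I. c i * f i s) t = (\<Sum>i\<in>I. c i * fractional_integral \<nu> (f i) t)"
proof -
  have int: "set_integrable lborel {0<..<t} (\<lambda>s. c i * ((t - s) powr (\<nu> - 1) * f i s))" if "i \<in> I" for i
    using assms that by (intro set_integrable_mult_right continuous_fractional_integrand_integrable) auto
  have "(LBINT s:{0<..<t}. (t - s) powr (\<nu> - 1) * (\<Sum>i\<in>I. c i * f i s)) =
      (LBINT s:{0<..<t}. \<Sum>i\<in>I. c i * ((t - s) powr (\<nu> - 1) * f i s))"
    by (simp add: sum_distrib_left mult_ac)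
  also have "\<dots> = (\<Sum>i\<in>I. c i * (LBINT s:{0<..<t}. (t - s) powr (\<nu> - 1) * f i s))"
    by (simp only: set_integral_finite_sum(2)[OF int] set_integral_mult_right)
  finally show ?thesis
    by (simp add: fractional_integral_def sum_divide_distrib)
qed

text \<open>
  All equations of the fractional system are integrated and then combined with the coefficients of the
  binomial transform, which decouples them.
\<close>

lemma fractional_yule_transform_volterra:
  fixes m :: nat
  assumes p: "fractional_yule_probs \<nu> lam p" and \<nu>: "0 < \<nu>" "\<nu> \<le> 1" and "t > 0"
  defines "c \<equiv> \<lambda>t. \<Sum>j\<le>m. real (m choose j) * (- 1) ^ j * p (Suc j) t"
  shows "continuous_on {0..} c" and "c t = 1 - lam * real (Suc m) * fractional_integral \<nu> c t"
proof -
  have p_cont: "continuous_on {0..} (p (Suc j))" and p_init: "p (Suc j) 0 = (if j = 0 then 1 else 0)"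
    and p_diff: "\<And>t. t > 0 \<Longrightarrow> caputo_differentiable \<nu> (p (Suc j)) t"
    and p_eq: "\<And>t. t > 0 \<Longrightarrow> caputo_deriv \<nu> (p (Suc j)) t = lam * (real j * p j t - real (Suc j) * p (Suc j) t)" for j
    using p[unfolded fractional_yule_probs_def, rule_format, of "Suc j"]
    by (auto simp: algebra_simps)
  show c_cont: "continuous_on {0..} c"
    unfolding c_def by (intro continuous_intros p_cont)
  define h where "h j t = real j * p j t - real (Suc j) * p (Suc j) t" for j t
  have h_cont: "continuous_on {0..} (h j)" for j
  proof (cases j)
    case 0
    then have "h j = (\<lambda>t. - p (Suc 0) t)" by (simp add: h_def fun_eq_iff)
    then show ?thesis using p_cont[of 0] by (auto intro!: continuous_intros)
  next
    case (Suc i)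
    show ?thesis
      unfolding h_def Suc by (intro continuous_intros p_cont)
  qed
  have volt: "p (Suc j) t = (if j = 0 then 1 else 0) + lam * fractional_integral \<nu> (h j) t" for j
  proof -
    have "p (Suc j) t = p (Suc j) 0 + fractional_integral \<nu> (\<lambda>t. lam * h j t) t"
    proof (rule caputo_imp_volterra[OF \<nu> \<open>t > 0\<close> p_cont])
      show "continuous_on {0..} (\<lambda>t. lam * h j t)"
        by (intro continuous_intros h_cont)
    qed (auto simp: p_diff p_eq h_def)
    also have "fractional_integral \<nu> (\<lambda>t. lam * h j t) t = lam * fractional_integral \<nu> (h j) t"
      using fractional_integral_linear_combination[of \<nu> t "{0}" "\<lambda>_. h j" "\<lambda>_. lam"] \<nu> \<open>t > 0\<close> h_cont by simp
    finally show ?thesis by (simp add: p_init)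
  qed
  have rec: "(\<Sum>j\<le>m. real (m choose j) * (- 1) ^ j * h j s) = - real (Suc m) * c s" for s
    using binomial_transform_recurrence[of m "\<lambda>j. p j s"] by (simp only: h_def c_def mult_minus_left)
  have "c t = (\<Sum>j\<le>m. real (m choose j) * (- 1) ^ j * (if j = 0 then 1 else 0)) +
      lam * (\<Sum>j\<le>m. real (m choose j) * (- 1) ^ j * fractional_integral \<nu> (h j) t)"
    unfolding c_def volt by (simp add: ring_distribs sum.distrib sum_distrib_left mult_ac)
  also have "(\<Sum>j\<le>m. real (m choose j) * (- 1) ^ j * (if j = 0 then 1 else 0)) = 1"
    by (simp add: if_distrib[where f = "\<lambda>x. _ * x"] sum.delta cong: if_cong)
  also have "(\<Sum>j\<le>m. real (m choose j) * (- 1) ^ j * fractional_integral \<nu> (h j) t) =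
      fractional_integral \<nu> (\<lambda>s. \<Sum>j\<le>m. real (m choose j) * (- 1) ^ j * h j s) t"
    using \<nu> \<open>t > 0\<close> h_cont by (subst fractional_integral_linear_combination) auto
  also have "\<dots> = - real (Suc m) * fractional_integral \<nu> c t"
    unfolding rec
    using fractional_integral_linear_combination[of \<nu> t "{0}" "\<lambda>_. c" "\<lambda>_. - real (Suc m)"] \<nu> \<open>t > 0\<close> c_cont by simp
  finally show "c t = 1 - lam * real (Suc m) * fractional_integral \<nu> c t"
    by (simp add: algebra_simps)
qed

lemma nat_distr_eqI:
  assumes "prob_space M" "prob_space M'"
    and N: "N \<in> M \<rightarrow>\<^sub>M count_space {1..}" and X: "X \<in> M' \<rightarrow>\<^sub>M count_space {1..}"
    and eq: "\<And>j. measure M {\<omega> \<in> space M. N \<omega> = Suc j} = measure M' {\<omega> \<in> space M'. X \<omega> = Suc j}"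
  shows "distr M (count_space UNIV) N = distr M' (count_space UNIV) X"
proof (rule measure_eqI_countable[of _ UNIV])
  fix k :: nat
  interpret M: prob_space M by fact
  interpret M': prob_space M' by fact
  have N': "N \<in> M \<rightarrow>\<^sub>M count_space UNIV" and X': "X \<in> M' \<rightarrow>\<^sub>M count_space UNIV"
    using measurable_compose[OF N, of "\<lambda>x. x" "count_space UNIV"]
      measurable_compose[OF X, of "\<lambda>x. x" "count_space UNIV"] by simp_all
  have NA: "N -` {k} \<inter> space M = {\<omega> \<in> space M. N \<omega> = k}" and XA: "X -` {k} \<inter> space M' = {\<omega> \<in> space M'. X \<omega> = k}"
    by auto
  have "measure M {\<omega> \<in> space M. N \<omega> = k} = measure M' {\<omega> \<in> space M'. X \<omega> = k}"
  proof (cases k)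
    case 0
    have empty: "{\<omega> \<in> space M. N \<omega> = 0} = {}" "{\<omega> \<in> space M'. X \<omega> = 0} = {}"
      using measurable_space[OF N] measurable_space[OF X] by force+
    show ?thesis unfolding 0 empty by simp
  qed (simp add: eq)
  then show "emeasure (distr M (count_space UNIV) N) {k} = emeasure (distr M' (count_space UNIV) X) {k}"
    using N' X' by (simp add: emeasure_distr NA XA M.emeasure_eq_measure M'.emeasure_eq_measure)
qed auto

theorem theorem3p2:
  fixes lam t \<nu> :: real
    and M :: "'a measure" and M' :: "'b measure"
    and N :: "real \<Rightarrow> 'a \<Rightarrow> nat"
    and \<Xi> :: "'b \<Rightarrow> real" and X :: "real \<Rightarrow> 'b \<Rightarrow> nat"
  assumes "lam > 0" and "t > 0" and "0 < \<nu>" and "\<nu> \<le> 1"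
    and "fractional_yule_process M \<nu> lam N"
    and "wright_distributed M' \<nu> \<Xi>"
    and "random_rate_yule_process M' lam \<Xi> X"
  shows "distr M (count_space UNIV) (N t) = distr M' (count_space UNIV) (X (t powr \<nu>))"
proof (rule nat_distr_eqI)
  define p where "p k t = measure M {\<omega> \<in> space M. N t \<omega> = k}" for k t
  have p: "fractional_yule_probs \<nu> lam p"
    using assms(5) by (simp add: fractional_yule_process_def p_def[abs_def])
  have M': "prob_space M'"
    using assms(7) by (simp add: random_rate_yule_process_def)
  show "prob_space M" "prob_space M'" "N t \<in> M \<rightarrow>\<^sub>M count_space {1..}" "X (t powr \<nu>) \<in> M' \<rightarrow>\<^sub>M count_space {1..}"
    using assms(2,5,7) by (auto simp: fractional_yule_process_def random_rate_yule_process_def)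
  fix j
  show "measure M {\<omega> \<in> space M. N t \<omega> = Suc j} = measure M' {\<omega> \<in> space M'. X (t powr \<nu>) \<omega> = Suc j}"
  proof (rule binomial_transform_inject[of "\<lambda>j. measure M {\<omega> \<in> space M. N t \<omega> = Suc j}"
        "\<lambda>j. measure M' {\<omega> \<in> space M'. X (t powr \<nu>) \<omega> = Suc j}"])
    fix m
    define a where "a = lam * real (Suc m)"
    have "a > 0" using assms(1) by (simp add: a_def)
    have "(\<lambda>n. (- (a * t powr \<nu>)) ^ n * rGamma (1 + \<nu> * real n)) sums (\<integral>\<omega>. exp (- (a * t powr \<nu> * \<Xi> \<omega>)) \<partial>M')"
      using \<open>a > 0\<close> by (intro wright_distributed_laplace assms M') simp
    moreover from sums_summable[OF this]
    have "(\<lambda>n. (- (a * t powr \<nu>)) ^ n * rGamma (1 + \<nu> * real n)) sums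
        (\<Sum>j\<le>m. real (m choose j) * (- 1) ^ j * p (Suc j) t)"
      using fractional_yule_transform_volterra[OF p assms(3,4)] assms(2,3) \<open>a > 0\<close>
      by (intro volterra_solution) (auto simp: a_def)
    ultimately have "(\<Sum>j\<le>m. real (m choose j) * (- 1) ^ j * p (Suc j) t) = (\<integral>\<omega>. exp (- (a * t powr \<nu> * \<Xi> \<omega>)) \<partial>M')"
      using sums_unique2 by blast
    also have "\<dots> = (\<Sum>j\<le>m. real (m choose j) * (- 1) ^ j * measure M' {\<omega> \<in> space M'. X (t powr \<nu>) \<omega> = Suc j})"
      unfolding a_def
      by (rule random_rate_yule_transform[OF assms(7,1) wright_distributed_pos[OF assms(4,6)], symmetric]) simp
    finally show "(\<Sum>j\<le>m. real (m choose j) * (- 1) ^ j * measure M {\<omega> \<in> space M. N t \<omega> = Suc j}) =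
        (\<Sum>j\<le>m. real (m choose j) * (- 1) ^ j * measure M' {\<omega> \<in> space M'. X (t powr \<nu>) \<omega> = Suc j})"
      by (simp add: p_def)
  qed
qed

end
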